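(* For all $\underline\alpha=(\alpha_0,\dots,\alpha_d)\in\Lambda$, the section $\theta_{\alpha_0}=\theta_{\alpha_0,\underline\alpha}\in\mathcal{O}(U_{\underline\alpha})$ vanishes nowhere on $T_\varphi\cap U_{\underline\alpha}$, and hence its restriction to $\mathcal{O}(T_\varphi\cap U_{\underline\alpha})$ is a unit. Moreover, the ideal of $T_\varphi\cap U_{\underline\alpha}$ in $\mathcal{O}(U_{\underline\alpha})$ is generated by the regular sequence $$\theta_{\alpha_0}z_{0}-\theta_{0},\ \ldots,\ \theta_{\alpha_0}z_{\alpha_0-1}-\theta_{\alpha_0-1},\ \theta_{\alpha_0}z_{\alpha_0+1}-\theta_{\alpha_0+1},\ \ldots,\ \theta_{\alpha_0}z_{d}-\theta_{d}.$$
   Context: Let $K$ be an algebraically closed field of characteristic zero, $d\ge 1$ an integer, $V=K[x,y]_1$ the space of linear forms in $x,y$, and $\lambda=(1^{e_1}2^{e_2}\cdots d^{e_d})$ a partition of $d$, where $e_r\ge 0$ is the number of parts equal to $r$ (so $\sum_{r=1}^d r e_r=d$). A closed point $(b_0:\cdots:b_k)$ of $\mathbb{P}(\mathrm{Sym}^kV)\cong\mathbb{P}^k_K$ is identified with the binary form $\sum_{j=0}^k b_jx^{k-j}y^j$ up to scalars in $K^*$. Put $Y_\lambda=\prod_{r=1}^d\mathbb{P}(\mathrm{Sym}^{e_r}V)$ and $T=\mathbb{P}(\mathrm{Sym}^dV)\times Y_\lambda$. Let $e_0=d$ and $\Lambda=\{0,\dots,e_0\}\times\{0,\dots,e_1\}\times\cdots\times\{0,\dots,e_d\}$.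 For $\underline\alpha=(\alpha_0,\dots,\alpha_d)\in\Lambda$ let $U_{\underline\alpha}=U_{\alpha_0}\times\cdots\times U_{\alpha_d}\subseteq T$, where $U_{\alpha_r}$ is the $\alpha_r$-th standard affine chart (the $\alpha_r$-th homogeneous coordinate is nonzero and normalized to $1$) of $\mathbb{P}(\mathrm{Sym}^{e_r}V)$, for $r=0,\dots,d$. The $U_{\underline\alpha}$ form an affine open cover of $T$. Let $z_j$ ($0\le j\le d$, $j\ne\alpha_0$) be the affine coordinates on $U_{\alpha_0}\subset\mathbb{P}(\mathrm{Sym}^dV)$, put $z_{\alpha_0}=1$, and let $w_{r,t}$ ($1\le r\le d$, $0\le t\le e_r$, $t\neq\alpha_r$) be the affine coordinates on $U_{\alpha_r}\subset\mathbb{P}(\mathrm{Sym}^{e_r}V)$; thus $\mathcal{O}(U_{\underline\alpha})$ is the polynomial ring over $K$ in all these coordinates. Let $\Theta_0,\dots,\Theta_d$ be the polynomials in indeterminates $W_{r,t}$ ($1\le r\le d$, $0\le t\le e_r$) defined by the identity $$\prod_{r=1}^d\Big(\sum_{t=0}^{e_r}W_{r,t}x^{e_r-t}y^t\Big)^r=\sum_{j=0}^d\Theta_j\,x^{d-j}y^j .$$ Let $\theta_{j}=\theta_{j,\underline\alpha}\in\mathcal{O}(U_{\underline\alpha})$ be obtained from $\Theta_j$ by substituting $W_{r,\alpha_r}\mapsto 1$ and $W_{r,t}\mapsto w_{r,t}$ for $t\ne\alpha_r$. Define the $2\times(d+1)$ matrix over $\mathcal{O}(U_{\underline\alpha})$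 $$(\varphi_{\underline\alpha})=\begin{pmatrix}\theta_{0}&\cdots&\theta_{\alpha_0-1}&\theta_{\alpha_0}&\theta_{\alpha_0+1}&\cdots&\theta_{d}\\ z_{0}&\cdots&z_{\alpha_0-1}&1&z_{\alpha_0+1}&\cdots&z_{d}\end{pmatrix}.$$ $T_\varphi$ denotes the closed subscheme of $T$ such that, for every $\underline\alpha\in\Lambda$, the ideal of $T_\varphi\cap U_{\underline\alpha}$ in $\mathcal{O}(U_{\underline\alpha})$ is generated by the $2\times2$-minors of $(\varphi_{\underline\alpha})$ (these local ideals, the zeroth Fitting ideals of the cokernels of the $\varphi_{\underline\alpha}$, agree on overlaps).
   Formalization: "Regular sequence" is proved for the germs in the local ring at each point of T_φ∩U_α, not in O(U_α) itself; there it fails in the listed order, e.g. for d=3, λ=(3^1), α_0=0, α_3=1, where the second element is a zero divisor modulo the first. *)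

theory Defs
  imports "HOL-Algebra.QuotRing" "HOL-Library.Poly_Mapping" "HOL-Computational_Algebra.Polynomial"
begin

section \<open>Polynomial rings in a set of variables\<close>

text \<open>
  Monomials are finitely supported exponent vectors and polynomials are finitely supported
  families of coefficients; multiplication on \<^typ>\<open>('v \<Rightarrow>\<^sub>0 nat) \<Rightarrow>\<^sub>0 'a::comm_ring_1\<close>
  is the convolution product of \<^theory>\<open>HOL-Library.Poly_Mapping\<close>.
\<close>

type_synonym ('v, 'a) mpoly = "('v \<Rightarrow>\<^sub>0 nat) \<Rightarrow>\<^sub>0 'a"

definition Const :: "'a \<Rightarrow> ('v, 'a::comm_ring_1) mpoly" where
  "Const c = Poly_Mapping.single 0 c"

definition Var :: "'v \<Rightarrow> ('v, 'a::comm_ring_1) mpoly" where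
  "Var v = Poly_Mapping.single (Poly_Mapping.single v 1) 1"

definition mpoly_subst :: "('v \<Rightarrow> ('w, 'a) mpoly) \<Rightarrow> ('v, 'a::comm_ring_1) mpoly \<Rightarrow> ('w, 'a) mpoly" where
  "mpoly_subst \<sigma> p =
     (\<Sum>m\<in>Poly_Mapping.keys p. Const (Poly_Mapping.lookup p m) *
        (\<Prod>v\<in>Poly_Mapping.keys m. \<sigma> v ^ Poly_Mapping.lookup m v))"

definition mpoly_ring :: "'v set \<Rightarrow> ('v, 'a::comm_ring_1) mpoly ring" where
  "mpoly_ring X =
     \<lparr>carrier = {p. \<forall>m\<in>Poly_Mapping.keys p. Poly_Mapping.keys m \<subseteq> X},
      monoid.mult = (*), one = 1, zero = 0, add = (+)\<rparr>"

lemma cring_mpoly_ring: "cring (mpoly_ring X :: ('v, 'a::comm_ring_1) mpoly ring)"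
proof -
  define C where "C = {p :: ('v, 'a) mpoly. \<forall>m\<in>Poly_Mapping.keys p. Poly_Mapping.keys m \<subseteq> X}"
  let ?R = "mpoly_ring X :: ('v, 'a) mpoly ring"
  have R: "carrier ?R = C" "monoid.mult ?R = (*)" "ring.add ?R = (+)" "\<one>\<^bsub>?R\<^esub> = 1" "\<zero>\<^bsub>?R\<^esub> = 0"
    by (simp_all add: mpoly_ring_def C_def)
  have add: "p + q \<in> C" if "p \<in> C" "q \<in> C" for p q
    using that Poly_Mapping.keys_add[of p q] unfolding C_def by blast
  have um: "- p \<in> C" if "p \<in> C" for p
    using that by (simp add: C_def)
  have mult: "p * q \<in> C" if p: "p \<in> C" and q: "q \<in> C" for p q
    unfolding C_def
  proof (intro CollectI ballI)
    fix m assume "m \<in> Poly_Mapping.keys (p * q)"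
    then obtain a b where "a \<in> Poly_Mapping.keys p" "b \<in> Poly_Mapping.keys q" "m = a + b"
      using Poly_Mapping.keys_mult[of p q] by blast
    thus "Poly_Mapping.keys m \<subseteq> X"
      using p q Poly_Mapping.keys_add[of a b] unfolding C_def by blast
  qed
  have one: "1 \<in> C" and zero: "0 \<in> C"
    by (simp_all add: C_def)
  show ?thesis
  proof (rule cringI)
    show "abelian_group ?R"
    proof (rule abelian_groupI, unfold R)
      fix p assume "p \<in> C"
      thus "\<exists>q\<in>C. q + p = 0" using um[of p] by (intro bexI[of _ "- p"]) simp_all
    qed (simp_all add: add zero add_ac)
    show "Group.comm_monoid ?R"
      by (rule comm_monoidI, unfold R) (simp_all add: mult one mult_ac)
  qed (unfold R, simp add: distrib_right)
qed

section \<open>Points, localizations and regular sequences\<close>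

definition Spec :: "('a, 'b) ring_scheme \<Rightarrow> 'a set set" where
  "Spec R = {P. primeideal P R}"

definition zero_locus :: "('a, 'b) ring_scheme \<Rightarrow> 'a set \<Rightarrow> 'a set set" where
  "zero_locus R I = {P \<in> Spec R. I \<subseteq> P}"

text \<open>The fraction $a/s$, as an equivalence class of pairs.\<close>

definition fraction :: "('a, 'b) ring_scheme \<Rightarrow> 'a set \<Rightarrow> 'a \<Rightarrow> 'a \<Rightarrow> ('a \<times> 'a) set" where
  "fraction R S a s =
     {(b, t). b \<in> carrier R \<and> t \<in> S \<and>
        (\<exists>u\<in>S. u \<otimes>\<^bsub>R\<^esub> (a \<otimes>\<^bsub>R\<^esub> t) = u \<otimes>\<^bsub>R\<^esub> (b \<otimes>\<^bsub>R\<^esub> s))}"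

definition localization :: "('a, 'b) ring_scheme \<Rightarrow> 'a set \<Rightarrow> ('a \<times> 'a) set ring" where
  "localization R S =
     \<lparr>carrier = {fraction R S a s | a s. a \<in> carrier R \<and> s \<in> S},
      monoid.mult = (\<lambda>X Y. \<Union>(a, s)\<in>X. \<Union>(b, t)\<in>Y. fraction R S (a \<otimes>\<^bsub>R\<^esub> b) (s \<otimes>\<^bsub>R\<^esub> t)),
      one = fraction R S \<one>\<^bsub>R\<^esub> \<one>\<^bsub>R\<^esub>,
      zero = fraction R S \<zero>\<^bsub>R\<^esub> \<one>\<^bsub>R\<^esub>,
      add = (\<lambda>X Y. \<Union>(a, s)\<in>X. \<Union>(b, t)\<in>Y.
               fraction R S (a \<otimes>\<^bsub>R\<^esub> t \<oplus>\<^bsub>R\<^esub> b \<otimes>\<^bsub>R\<^esub> s) (s \<otimes>\<^bsub>R\<^esub> t))\<rparr>"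

definition local_ring_at :: "('a, 'b) ring_scheme \<Rightarrow> 'a set \<Rightarrow> ('a \<times> 'a) set ring" where
  "local_ring_at R P = localization R (carrier R - P)"

definition germ :: "('a, 'b) ring_scheme \<Rightarrow> 'a set \<Rightarrow> 'a \<Rightarrow> ('a \<times> 'a) set" where
  "germ R P a = fraction R (carrier R - P) a \<one>\<^bsub>R\<^esub>"

lemma UN2_eq:
  assumes "x0 \<in> X" "y0 \<in> Y" "\<And>a s b t. (a, s) \<in> X \<Longrightarrow> (b, t) \<in> Y \<Longrightarrow> f a s b t = F"
  shows "(\<Union>(a, s)\<in>X. \<Union>(b, t)\<in>Y. f a s b t) = F"
proof -
  have F: "(case x of (a, s) \<Rightarrow> case y of (b, t) \<Rightarrow> f a s b t) = F" if "x \<in> X" "y \<in> Y" for x y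
    using assms(3) that by (cases x, cases y) simp
  have "(case x of (a, s) \<Rightarrow> \<Union>(b, t)\<in>Y. f a s b t) = F" if "x \<in> X" for x
  proof -
    have "(case x of (a, s) \<Rightarrow> \<Union>(b, t)\<in>Y. f a s b t) = (\<Union>y\<in>Y. case x of (a, s) \<Rightarrow> case y of (b, t) \<Rightarrow> f a s b t)"
      by (cases x) simp
    thus ?thesis using assms(2) by (auto simp: F[OF that])
  qed
  thus ?thesis using assms(1) by auto
qed

context cring
begin

context
  fixes S
  assumes S_sub: "S \<subseteq> carrier R" and S_one: "\<one> \<in> S"
    and S_mult: "\<And>s t. s \<in> S \<Longrightarrow> t \<in> S \<Longrightarrow> s \<otimes> t \<in> S"
begin

lemma fraction_eq_iff:
  assumes "a \<in> carrier R" "b \<in> carrier R" "s \<in> S" "t \<in> S"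
  shows "fraction R S a s = fraction R S b t \<longleftrightarrow> (\<exists>u\<in>S. u \<otimes> (a \<otimes> t) = u \<otimes> (b \<otimes> s))"
proof
  assume "fraction R S a s = fraction R S b t"
  moreover have "(b, t) \<in> fraction R S b t" unfolding fraction_def using assms(2,4) S_one by blast
  ultimately have "(b, t) \<in> fraction R S a s" by (simp only:)
  thus "\<exists>u\<in>S. u \<otimes> (a \<otimes> t) = u \<otimes> (b \<otimes> s)" unfolding fraction_def by blast
next
  have main: "fraction R S a s \<subseteq> fraction R S b t"
    if ab: "a \<in> carrier R" "b \<in> carrier R" "s \<in> S" "t \<in> S"
    and u: "u \<in> S" "u \<otimes> (a \<otimes> t) = u \<otimes> (b \<otimes> s)" for a b s t u
  proof (clarsimp simp: fraction_def)
    fix c r v assume c: "c \<in> carrier R" "r \<in> S" "v \<in> S" "v \<otimes> (a \<otimes> r) = v \<otimes> (c \<otimes> s)"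
    have car: "s \<in> carrier R" "t \<in> carrier R" "u \<in> carrier R" "r \<in> carrier R" "v \<in> carrier R"
      using ab(3,4) u(1) c(2,3) S_sub by blast+
    have "(u \<otimes> v \<otimes> s) \<otimes> (b \<otimes> r) = v \<otimes> r \<otimes> (u \<otimes> (b \<otimes> s))"
      using ab(1,2) c(1) car by (simp add: m_ac)
    also have "\<dots> = v \<otimes> r \<otimes> (u \<otimes> (a \<otimes> t))"
      by (simp only: u(2))
    also have "\<dots> = u \<otimes> t \<otimes> (v \<otimes> (a \<otimes> r))"
      using ab(1,2) c(1) car by (simp add: m_ac)
    also have "\<dots> = u \<otimes> t \<otimes> (v \<otimes> (c \<otimes> s))"
      by (simp only: c(4))
    also have "\<dots> = (u \<otimes> v \<otimes> s) \<otimes> (c \<otimes> t)"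
      using ab(1,2) c(1) car by (simp add: m_ac)
    finally have "(u \<otimes> v \<otimes> s) \<otimes> (b \<otimes> r) = (u \<otimes> v \<otimes> s) \<otimes> (c \<otimes> t)" .
    moreover have "u \<otimes> v \<otimes> s \<in> S" using S_mult u(1) c(3) ab(3) by blast
    ultimately show "\<exists>u\<in>S. u \<otimes> (b \<otimes> r) = u \<otimes> (c \<otimes> t)" by (rule bexI)
  qed
  assume "\<exists>u\<in>S. u \<otimes> (a \<otimes> t) = u \<otimes> (b \<otimes> s)"
  then obtain u where "u \<in> S" "u \<otimes> (a \<otimes> t) = u \<otimes> (b \<otimes> s)" by blast
  from main[OF assms this] main[OF assms(2,1,4,3) this(1) this(2)[symmetric]]
  show "fraction R S a s = fraction R S b t" by (rule equalityI)
qed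

lemma mem_fraction:
  assumes "(a', s') \<in> fraction R S a s" "a \<in> carrier R" "s \<in> S"
  shows "a' \<in> carrier R" "s' \<in> S" "fraction R S a' s' = fraction R S a s"
proof -
  have *: "a' \<in> carrier R \<and> s' \<in> S \<and> (\<exists>u\<in>S. u \<otimes> (a \<otimes> s') = u \<otimes> (a' \<otimes> s))"
    using assms(1) unfolding fraction_def by blast
  thus c: "a' \<in> carrier R" "s' \<in> S" by blast+
  show "fraction R S a' s' = fraction R S a s"
    using fraction_eq_iff[OF assms(2) c(1) assms(3) c(2)] * by metis
qed

lemma fraction_self: "a \<in> carrier R \<Longrightarrow> s \<in> S \<Longrightarrow> (a, s) \<in> fraction R S a s"
  unfolding fraction_def using S_one by blast

lemma localization_mult:
  assumes "a \<in> carrier R" "s \<in> S" "b \<in> carrier R" "t \<in> S"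
  shows "fraction R S a s \<otimes>\<^bsub>localization R S\<^esub> fraction R S b t = fraction R S (a \<otimes> b) (s \<otimes> t)"
proof -
  have "fraction R S (a' \<otimes> b') (s' \<otimes> t') = fraction R S (a \<otimes> b) (s \<otimes> t)"
    if m: "(a', s') \<in> fraction R S a s" "(b', t') \<in> fraction R S b t" for a' s' b' t'
  proof -
    note c = mem_fraction[OF m(1) assms(1,2)] mem_fraction[OF m(2) assms(3,4)]
    obtain u v where u: "u \<in> S" "u \<otimes> (a \<otimes> s') = u \<otimes> (a' \<otimes> s)"
      and v: "v \<in> S" "v \<otimes> (b \<otimes> t') = v \<otimes> (b' \<otimes> t)"
      using m unfolding fraction_def by blast
    have car: "s \<in> carrier R" "t \<in> carrier R" "s' \<in> carrier R" "t' \<in> carrier R"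
      "u \<in> carrier R" "v \<in> carrier R" using assms(2,4) c(2,5) u(1) v(1) S_sub by blast+
    have "(u \<otimes> v) \<otimes> ((a' \<otimes> b') \<otimes> (s \<otimes> t)) = (u \<otimes> (a' \<otimes> s)) \<otimes> (v \<otimes> (b' \<otimes> t))"
      using assms(1,3) c(1,4) car by (simp add: m_ac)
    also have "\<dots> = (u \<otimes> (a \<otimes> s')) \<otimes> (v \<otimes> (b \<otimes> t'))"
      by (simp only: u(2) v(2))
    also have "\<dots> = (u \<otimes> v) \<otimes> ((a \<otimes> b) \<otimes> (s' \<otimes> t'))"
      using assms(1,3) c(1,4) car by (simp add: m_ac)
    finally have eq: "(u \<otimes> v) \<otimes> ((a' \<otimes> b') \<otimes> (s \<otimes> t)) = (u \<otimes> v) \<otimes> ((a \<otimes> b) \<otimes> (s' \<otimes> t'))" .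
    have car': "s \<otimes> t \<in> S" "s' \<otimes> t' \<in> S" "u \<otimes> v \<in> S"
      using assms(2,4) c(2,5) u(1) v(1) S_mult by blast+
    show ?thesis
      by (rule fraction_eq_iff[THEN iffD2])
         (rule m_closed a_closed assms c car car' | rule bexI, rule eq)+
  qed
  thus ?thesis
    by (simp add: localization_def)
       (rule UN2_eq[OF fraction_self[OF assms(1,2)] fraction_self[OF assms(3,4)]], blast)
qed

lemma localization_add:
  assumes "a \<in> carrier R" "s \<in> S" "b \<in> carrier R" "t \<in> S"
  shows "fraction R S a s \<oplus>\<^bsub>localization R S\<^esub> fraction R S b t = fraction R S (a \<otimes> t \<oplus> b \<otimes> s) (s \<otimes> t)"
proof -
  have "fraction R S (a' \<otimes> t' \<oplus> b' \<otimes> s') (s' \<otimes> t') = fraction R S (a \<otimes> t \<oplus> b \<otimes> s) (s \<otimes> t)"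
    if m: "(a', s') \<in> fraction R S a s" "(b', t') \<in> fraction R S b t" for a' s' b' t'
  proof -
    note c = mem_fraction[OF m(1) assms(1,2)] mem_fraction[OF m(2) assms(3,4)]
    obtain u v where u: "u \<in> S" "u \<otimes> (a \<otimes> s') = u \<otimes> (a' \<otimes> s)"
      and v: "v \<in> S" "v \<otimes> (b \<otimes> t') = v \<otimes> (b' \<otimes> t)"
      using m unfolding fraction_def by blast
    have car: "s \<in> carrier R" "t \<in> carrier R" "s' \<in> carrier R" "t' \<in> carrier R"
      "u \<in> carrier R" "v \<in> carrier R" using assms(2,4) c(2,5) u(1) v(1) S_sub by blast+
    have "(u \<otimes> v) \<otimes> ((a' \<otimes> t' \<oplus> b' \<otimes> s') \<otimes> (s \<otimes> t))
        = (u \<otimes> (a' \<otimes> s)) \<otimes> (v \<otimes> (t \<otimes> t')) \<oplus> (v \<otimes> (b' \<otimes> t)) \<otimes> (u \<otimes> (s \<otimes> s'))"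
      using assms(1,3) c(1,4) car by (simp add: m_ac l_distr r_distr)
    also have "\<dots> = (u \<otimes> (a \<otimes> s')) \<otimes> (v \<otimes> (t \<otimes> t')) \<oplus> (v \<otimes> (b \<otimes> t')) \<otimes> (u \<otimes> (s \<otimes> s'))"
      by (simp only: u(2) v(2))
    also have "\<dots> = (u \<otimes> v) \<otimes> ((a \<otimes> t \<oplus> b \<otimes> s) \<otimes> (s' \<otimes> t'))"
      using assms(1,3) c(1,4) car by (simp add: m_ac l_distr r_distr)
    finally have eq: "(u \<otimes> v) \<otimes> ((a' \<otimes> t' \<oplus> b' \<otimes> s') \<otimes> (s \<otimes> t))
      = (u \<otimes> v) \<otimes> ((a \<otimes> t \<oplus> b \<otimes> s) \<otimes> (s' \<otimes> t'))" .
    have car': "s \<otimes> t \<in> S" "s' \<otimes> t' \<in> S" "u \<otimes> v \<in> S"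
      using assms(2,4) c(2,5) u(1) v(1) S_mult by blast+
    show ?thesis
      by (rule fraction_eq_iff[THEN iffD2])
         (rule m_closed a_closed assms c car car' | rule bexI, rule eq)+
  qed
  thus ?thesis
    by (simp add: localization_def)
       (rule UN2_eq[OF fraction_self[OF assms(1,2)] fraction_self[OF assms(3,4)]], blast)
qed

lemma fraction_carrier: "a \<in> carrier R \<Longrightarrow> s \<in> S \<Longrightarrow> fraction R S a s \<in> carrier (localization R S)"
  by (auto simp: localization_def)

lemma cring_localization: "cring (localization R S)"
proof -
  let ?L = "localization R S"
  have car: "s \<in> S \<Longrightarrow> s \<in> carrier R" for s using S_sub by auto
  have one: "\<one>\<^bsub>?L\<^esub> = fraction R S \<one> \<one>" and zero: "\<zero>\<^bsub>?L\<^esub> = fraction R S \<zero> \<one>"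
    by (simp_all add: localization_def)
  have E: "\<exists>a\<in>carrier R. \<exists>s\<in>S. X = fraction R S a s" if "X \<in> carrier ?L" for X
    using that by (auto simp: localization_def)
  have eqI: "fraction R S a s = fraction R S b t"
    if "a \<in> carrier R" "b \<in> carrier R" "s \<in> S" "t \<in> S" "a \<otimes> t = b \<otimes> s" for a b s t
    using fraction_eq_iff[OF that(1-4)] that(5) S_one by metis
  note ops = localization_mult localization_add one zero S_mult S_one car fraction_carrier
  show ?thesis
  proof (rule cringI, rule abelian_groupI)
    fix X assume "X \<in> carrier ?L"
    then obtain a s where X: "a \<in> carrier R" "s \<in> S" "X = fraction R S a s" using E by blast
    have "fraction R S (\<ominus> a) s \<oplus>\<^bsub>?L\<^esub> X = \<zero>\<^bsub>?L\<^esub>"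
      using X car by (simp add: ops) (rule eqI, auto simp: ops l_minus l_neg)
    thus "\<exists>Y\<in>carrier ?L. Y \<oplus>\<^bsub>?L\<^esub> X = \<zero>\<^bsub>?L\<^esub>" using X fraction_carrier[of "\<ominus> a" s] by auto
  next
    show "Group.comm_monoid ?L"
    proof (rule comm_monoidI)
      fix X Y assume "X \<in> carrier ?L" "Y \<in> carrier ?L"
      then obtain a s b t where X: "a \<in> carrier R" "s \<in> S" "X = fraction R S a s"
        "b \<in> carrier R" "t \<in> S" "Y = fraction R S b t" using E by metis
      show "X \<otimes>\<^bsub>?L\<^esub> Y \<in> carrier ?L" using X by (simp add: ops)
      show "X \<otimes>\<^bsub>?L\<^esub> Y = Y \<otimes>\<^bsub>?L\<^esub> X" using X by (simp add: ops m_ac)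
    next
      fix X Y Z assume "X \<in> carrier ?L" "Y \<in> carrier ?L" "Z \<in> carrier ?L"
      then obtain a s b t c r where X: "a \<in> carrier R" "s \<in> S" "X = fraction R S a s"
        "b \<in> carrier R" "t \<in> S" "Y = fraction R S b t"
        "c \<in> carrier R" "r \<in> S" "Z = fraction R S c r" using E by metis
      show "X \<otimes>\<^bsub>?L\<^esub> Y \<otimes>\<^bsub>?L\<^esub> Z = X \<otimes>\<^bsub>?L\<^esub> (Y \<otimes>\<^bsub>?L\<^esub> Z)"
        using X by (simp add: ops m_ac)
    next
      fix X assume "X \<in> carrier ?L"
      then obtain a s where X: "a \<in> carrier R" "s \<in> S" "X = fraction R S a s" using E by blast
      show "\<one>\<^bsub>?L\<^esub> \<otimes>\<^bsub>?L\<^esub> X = X" using X by (simp add: ops)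
    next
      show "\<one>\<^bsub>?L\<^esub> \<in> carrier ?L" by (simp add: ops)
    qed
  next
    fix X Y assume "X \<in> carrier ?L" "Y \<in> carrier ?L"
    then obtain a s b t where X: "a \<in> carrier R" "s \<in> S" "X = fraction R S a s"
      "b \<in> carrier R" "t \<in> S" "Y = fraction R S b t" using E by metis
    show "X \<oplus>\<^bsub>?L\<^esub> Y \<in> carrier ?L" using X by (simp add: ops)
    show "X \<oplus>\<^bsub>?L\<^esub> Y = Y \<oplus>\<^bsub>?L\<^esub> X" using X by (simp add: ops m_ac a_ac)
  next
    fix X Y Z assume "X \<in> carrier ?L" "Y \<in> carrier ?L" "Z \<in> carrier ?L"
    then obtain a s b t c r where X: "a \<in> carrier R" "s \<in> S" "X = fraction R S a s"
      "b \<in> carrier R" "t \<in> S" "Y = fraction R S b t"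
      "c \<in> carrier R" "r \<in> S" "Z = fraction R S c r" using E by metis
    show "X \<oplus>\<^bsub>?L\<^esub> Y \<oplus>\<^bsub>?L\<^esub> Z = X \<oplus>\<^bsub>?L\<^esub> (Y \<oplus>\<^bsub>?L\<^esub> Z)"
      using X by (simp add: ops m_ac a_ac l_distr r_distr)
    show "(X \<oplus>\<^bsub>?L\<^esub> Y) \<otimes>\<^bsub>?L\<^esub> Z = X \<otimes>\<^bsub>?L\<^esub> Z \<oplus>\<^bsub>?L\<^esub> Y \<otimes>\<^bsub>?L\<^esub> Z"
      using X by (simp add: ops) (rule eqI, simp_all add: ops m_ac l_distr r_distr)
  next
    fix X assume "X \<in> carrier ?L"
    then obtain a s where X: "a \<in> carrier R" "s \<in> S" "X = fraction R S a s" using E by blast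
    show "\<zero>\<^bsub>?L\<^esub> \<oplus>\<^bsub>?L\<^esub> X = X" using X by (simp add: ops)
  next
    show "\<zero>\<^bsub>?L\<^esub> \<in> carrier ?L" by (simp add: ops)
  qed
qed

end

lemma cring_local_ring_at:
  assumes "primeideal P R"
  shows "cring (local_ring_at R P)"
proof -
  interpret primeideal P R by fact
  show ?thesis unfolding local_ring_at_def
    by (rule cring_localization) (use I_prime I_notcarr one_imp_carrier in auto)
qed

end

definition nonzerodivisor :: "('a, 'b) ring_scheme \<Rightarrow> 'a \<Rightarrow> bool" where
  "nonzerodivisor R a \<longleftrightarrow>
     a \<in> carrier R \<and> (\<forall>x\<in>carrier R. a \<otimes>\<^bsub>R\<^esub> x = \<zero>\<^bsub>R\<^esub> \<longrightarrow> x = \<zero>\<^bsub>R\<^esub>)"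

definition regular_sequence :: "('a, 'b) ring_scheme \<Rightarrow> 'a list \<Rightarrow> bool" where
  "regular_sequence R fs \<longleftrightarrow>
     set fs \<subseteq> carrier R \<and>
     (\<forall>i<length fs. let J = genideal R (set (take i fs)) in
        nonzerodivisor (R Quot J) (J +>\<^bsub>R\<^esub> (fs ! i))) \<and>
     genideal R (set fs) \<noteq> carrier R"

text \<open>
  A sequence of sections of an affine scheme is regular along the closed subscheme it cuts out
  if that subscheme is nonempty and the germs form a regular sequence in the local ring of the
  ambient scheme at each of its points (over a Noetherian ring: the sequence is Koszul-regular).
  Requiring \<^const>\<open>regular_sequence\<close> in the ring of global sections instead would be
  sensitive to components away from the subscheme: for $d = 3$, $\lambda = (3^1)$,
  $\alpha_0 = 0$, $\alpha_3 = 1$ the equations of the theorem are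
  $f_1 = w^3z_1-3w^2$, $f_2 = w^3z_2-3w$, $f_3 = w^3z_3-1$; here $w$ is a unit on $T_\varphi$, but
  $w(wz_1-3) f_2 = (w^2z_2-3) f_1$ while $w(wz_1-3) \notin (f_1) = (w^2(wz_1-3))$, so $f_2$ is a
  zero divisor modulo $f_1$ in $K[w,z_1,z_2,z_3]$.
\<close>

definition regular_along_zero_locus :: "('a, 'b) ring_scheme \<Rightarrow> 'a list \<Rightarrow> bool" where
  "regular_along_zero_locus R fs \<longleftrightarrow>
     set fs \<subseteq> carrier R \<and> genideal R (set fs) \<noteq> carrier R \<and>
     (\<forall>P\<in>zero_locus R (set fs). regular_sequence (local_ring_at R P) (map (germ R P) fs))"

section \<open>The charts of $T$ and the scheme $T_\varphi$\<close>

text \<open>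
  A partition $(1^{e_1}\cdots d^{e_d})$ is given by \<^term>\<open>e :: nat \<Rightarrow> nat\<close>, of which only the values
  at $1,\dots,d$ matter; in particular the convention $e_0 = d$ is imposed here and
  \<^term>\<open>e 0 :: nat\<close> is never used.
\<close>

definition e_ext :: "nat \<Rightarrow> (nat \<Rightarrow> nat) \<Rightarrow> nat \<Rightarrow> nat" where
  "e_ext d e = e(0 := d)"

definition Lam :: "nat \<Rightarrow> (nat \<Rightarrow> nat) \<Rightarrow> (nat \<Rightarrow> nat) set" where
  "Lam d e = (\<Pi>\<^sub>E r\<in>{0..d}. {0..e_ext d e r})"

text \<open>
  The variable $(0,j)$ is $z_j$, and $(r,t)$ with $r \ge 1$ is $w_{r,t}$ (on a chart) or
  $W_{r,t}$ (in $\Theta_j$).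
\<close>

definition chart_vars :: "nat \<Rightarrow> (nat \<Rightarrow> nat) \<Rightarrow> (nat \<Rightarrow> nat) \<Rightarrow> (nat \<times> nat) set" where
  "chart_vars d e \<alpha> = {(r, t). r \<le> d \<and> t \<le> e_ext d e r \<and> t \<noteq> \<alpha> r}"

definition chart_ring ::
    "nat \<Rightarrow> (nat \<Rightarrow> nat) \<Rightarrow> (nat \<Rightarrow> nat) \<Rightarrow> (nat \<times> nat, 'k::field) mpoly ring" where
  "chart_ring d e \<alpha> = mpoly_ring (chart_vars d e \<alpha>)"

definition coord :: "(nat \<Rightarrow> nat) \<Rightarrow> nat \<times> nat \<Rightarrow> (nat \<times> nat, 'k::field) mpoly" where
  "coord \<alpha> = (\<lambda>(r, t). if t = \<alpha> r then 1 else Var (r, t))"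

abbreviation z_coord :: "(nat \<Rightarrow> nat) \<Rightarrow> nat \<Rightarrow> (nat \<times> nat, 'k::field) mpoly" where
  "z_coord \<alpha> j \<equiv> coord \<alpha> (0, j)"

text \<open>Forms in $x,y$ have coefficients in the polynomials in the $W_{r,t}$; $x$ and $y$ are the
  variables $0$ and $1$.\<close>

definition xy_monomial :: "nat \<Rightarrow> nat \<Rightarrow> (nat, 'a::comm_ring_1) mpoly" where
  "xy_monomial i j = Var 0 ^ i * Var 1 ^ j"

definition generic_product ::
    "nat \<Rightarrow> (nat \<Rightarrow> nat) \<Rightarrow> (nat, (nat \<times> nat, 'k::field) mpoly) mpoly" where
  "generic_product d e =
     (\<Prod>r=1..d. (\<Sum>t=0..e r. Const (Var (r, t)) * xy_monomial (e r - t) t) ^ r)"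

definition Theta :: "nat \<Rightarrow> (nat \<Rightarrow> nat) \<Rightarrow> nat \<Rightarrow> (nat \<times> nat, 'k::field) mpoly" where
  "Theta d e j =
     Poly_Mapping.lookup (generic_product d e)
       (Poly_Mapping.single 0 (d - j) + Poly_Mapping.single 1 j)"

lemma Const_add: "Const (a + b) = Const a + Const b"
  by (simp add: Const_def single_add)

lemma Const_0: "Const 0 = 0"
  by (simp add: Const_def)

lemma Const_mult: "Const (a * b) = Const a * Const b"
  by (simp add: Const_def mult_single)

lemma Var_power: "Var v ^ n = Poly_Mapping.single (Poly_Mapping.single v n) 1"
  by (induction n) (simp_all add: Var_def mult_single flip: single_add)

lemma Const_xy: "Const a * xy_monomial i j = 
   Poly_Mapping.single (Poly_Mapping.single 0 i + Poly_Mapping.single 1 j) a"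
  by (simp add: Const_def xy_monomial_def Var_power mult_single)

lemma xy_mult: "i \<le> m \<Longrightarrow> j \<le> n \<Longrightarrow>
  xy_monomial (m - i) i * xy_monomial (n - j) j = xy_monomial (m + n - (i + j)) (i + j)"
proof -
  assume "i \<le> m" "j \<le> n"
  hence e: "m + n - (i + j) = (m - i) + (n - j)" by simp
  show ?thesis by (simp add: xy_monomial_def e power_add mult_ac)
qed

definition is_form :: "nat \<Rightarrow> (nat, 'a::comm_ring_1) mpoly \<Rightarrow> bool" where
  "is_form n p \<longleftrightarrow> (\<exists>c. p = (\<Sum>j=0..n. Const (c j) * xy_monomial (n - j) j))"

lemma is_form_mult:
  assumes "is_form m p" "is_form n q" shows "is_form (m + n) (p * q)"
proof -
  obtain a b where p: "p = (\<Sum>j=0..m. Const (a j) * xy_monomial (m - j) j)"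
    and q: "q = (\<Sum>j=0..n. Const (b j) * xy_monomial (n - j) j)"
    using assms by (auto simp: is_form_def)
  let ?g = "\<lambda>(i,j). a i * b j"
  let ?A = "{0..m} \<times> {0..n}"
  have C0: "Const (sum f F) = (\<Sum>x\<in>F. Const (f x))" for f :: "nat \<times> nat \<Rightarrow> 'a" and F
    by (induction F rule: infinite_finite_induct) (simp_all add: Const_add Const_0)
  have "p * q = (\<Sum>x\<in>?A. Const (?g x) * xy_monomial (m + n - (fst x + snd x)) (fst x + snd x))"
    unfolding p q sum_product sum.cartesian_product
    by (rule sum.cong[OF refl]) (auto simp: Const_mult mult_ac simp flip: xy_mult)
  also have "\<dots> = (\<Sum>k=0..m+n. \<Sum>x\<in>{x\<in>?A. fst x + snd x = k}. Const (?g x) * xy_monomial (m + n - (fst x + snd x)) (fst x + snd x))"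
    by (rule sum.group[symmetric]) auto
  also have "\<dots> = (\<Sum>k=0..m+n. Const (\<Sum>x\<in>{x\<in>?A. fst x + snd x = k}. ?g x) * xy_monomial (m + n - k) k)"
    by (intro sum.cong) (auto simp: C0 sum_distrib_right intro!: sum.cong)
  finally show ?thesis unfolding is_form_def by (intro exI)
qed

lemma is_form_1: "is_form 0 1"
  by (auto simp: is_form_def xy_monomial_def Const_def intro!: exI[of _ "\<lambda>_. 1"])

lemma is_form_power: "is_form m p \<Longrightarrow> is_form (n * m) (p ^ n)"
  by (induction n) (auto simp: is_form_1 is_form_mult)

lemma is_form_prod: "finite F \<Longrightarrow> (\<And>r. r \<in> F \<Longrightarrow> is_form (g r) (f r)) \<Longrightarrow> is_form (sum g F) (prod f F)"
  by (induction F rule: finite_induct) (auto simp: is_form_1 is_form_mult)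

text \<open>The identity that defines the $\Theta_j$.\<close>

lemma Theta_identity:
  assumes "(\<Sum>r=1..d. r * e r) = d"
  shows "(generic_product d e :: (nat, (nat \<times> nat, 'k::field) mpoly) mpoly) = (\<Sum>j=0..d. Const (Theta d e j) * xy_monomial (d - j) j)"
proof -
  have "is_form d (generic_product d e :: (nat, (nat \<times> nat, 'k) mpoly) mpoly)"
    unfolding generic_product_def
    by (subst assms[symmetric], rule is_form_prod, simp, rule is_form_power)
       (auto simp: is_form_def)
  then obtain c :: "nat \<Rightarrow> (nat \<times> nat, 'k) mpoly" where c: "generic_product d e = (\<Sum>j=0..d. Const (c j) * xy_monomial (d - j) j)"
    by (auto simp: is_form_def)
  have inj: "Poly_Mapping.single 0 (d - i) + Poly_Mapping.single 1 i =
      Poly_Mapping.single 0 (d - j) + Poly_Mapping.single (1::nat) j \<longleftrightarrow> i = j" for i j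
  proof
    assume "Poly_Mapping.single 0 (d - i) + Poly_Mapping.single 1 i =
      Poly_Mapping.single 0 (d - j) + Poly_Mapping.single (1::nat) j"
    from arg_cong[OF this, of "\<lambda>m. Poly_Mapping.lookup m 1"] show "i = j"
      by (simp add: lookup_add lookup_single)
  qed simp
  have "Theta d e j = c j" if "j \<le> d" for j
    using that
    by (simp add: Theta_def c Const_xy lookup_sum lookup_single inj[unfolded One_nat_def] when_def)
  thus ?thesis unfolding c by (intro sum.cong) auto
qed

definition theta ::
    "nat \<Rightarrow> (nat \<Rightarrow> nat) \<Rightarrow> (nat \<Rightarrow> nat) \<Rightarrow> nat \<Rightarrow> (nat \<times> nat, 'k::field) mpoly" where
  "theta d e \<alpha> j = mpoly_subst (coord \<alpha>) (Theta d e j)"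

text \<open>Rows are indexed by $0,1$ and columns by $0,\dots,d$.\<close>

definition phi_matrix ::
    "nat \<Rightarrow> (nat \<Rightarrow> nat) \<Rightarrow> (nat \<Rightarrow> nat) \<Rightarrow> nat \<Rightarrow> nat \<Rightarrow> (nat \<times> nat, 'k::field) mpoly" where
  "phi_matrix d e \<alpha> i j = (if i = 0 then theta d e \<alpha> j else z_coord \<alpha> j)"

definition two_minors :: "nat \<Rightarrow> (nat \<Rightarrow> nat \<Rightarrow> 'a::comm_ring_1) \<Rightarrow> 'a set" where
  "two_minors d M = {M 0 i * M 1 j - M 0 j * M 1 i | i j. i < j \<and> j \<le> d}"

text \<open>The ideal of $T_\varphi \cap U_{\underline\alpha}$ in $\mathcal{O}(U_{\underline\alpha})$.\<close>

definition T_phi_ideal ::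
    "nat \<Rightarrow> (nat \<Rightarrow> nat) \<Rightarrow> (nat \<Rightarrow> nat) \<Rightarrow> (nat \<times> nat, 'k::field) mpoly set" where
  "T_phi_ideal d e \<alpha> = genideal (chart_ring d e \<alpha>) (two_minors d (phi_matrix d e \<alpha>))"

definition graph_equations ::
    "nat \<Rightarrow> (nat \<Rightarrow> nat) \<Rightarrow> (nat \<Rightarrow> nat) \<Rightarrow> (nat \<times> nat, 'k::field) mpoly list" where
  "graph_equations d e \<alpha> =
     map (\<lambda>j. theta d e \<alpha> (\<alpha> 0) * z_coord \<alpha> j - theta d e \<alpha> j)
       (filter (\<lambda>j. j \<noteq> \<alpha> 0) [0..<Suc d])"

end

theory Submission
  imports Defs "HOL-Library.Product_Lexorder" "HOL-Algebra.Ring_Divisibility"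
    "HOL-Computational_Algebra.Polynomial_Factorial"
begin

text \<open>
  On a chart, put $g_j = \theta_{\alpha_0}z_j - \theta_j$. As $z_{\alpha_0} = 1$, these are minors
  up to sign, and all other minors are combinations of them, so that the two ideals agree
  (\<open>T_phi_ideal_eq\<close>). Geometrically, the $g_j$ describe the graph of the morphism that multiplies
  the forms.

  The function $\theta_{\alpha_0}$ vanishes nowhere on the graph: where it vanishes, all $\theta_j$
  vanish, that is, the product of the normalized forms is zero. But over a domain a product of nonzero
  forms is not zero (\<open>theta_not_in_prime\<close>). As every proper ideal lies in a prime ideal, it
  follows that $\theta_{\alpha_0}$ is a unit on $T_\varphi$ (\<open>coset_Units_if_avoids_primes\<close>).

  Near the graph $\theta_{\alpha_0}$ is therefore invertible, and $g_j$ amounts to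
  $z_j - \theta_j/\theta_{\alpha_0}$, where the $\theta$'s involve no $z$. Each equation thus eliminates
  one variable. Modulo some of the equations the localized ring embeds in a field of fractions,
  where the next $g_j$ is nonzero and hence no zero divisor (\<open>eliminate_z\<close>,
  \<open>regular_sequence_graph_germs\<close>). That the equations have a common zero at all is seen at the forms
  proportional to $(x+y)^{e_r}$, where characteristic $0$ enters (\<open>graph_equations_proper\<close>).

  The lexicographic order on pairs serves to order the variables, and thereby the monomials, which
  makes the polynomial ring an instance of \<^class>\<open>idom\<close> and gives it a field of fractions.
\<close>

section \<open>Evaluation of polynomials\<close>

locale unital_ring_hom =
  fixes h :: "'a::comm_ring_1 \<Rightarrow> 'b::comm_ring_1"
  assumes hom_add: "h (x + y) = h x + h y"
    and hom_mult: "h (x * y) = h x * h y"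
    and hom_one: "h 1 = 1"
begin

lemma hom_zero: "h 0 = 0"
  using hom_add[of 0 0] by simp

lemma hom_uminus: "h (- x) = - h x"
  using hom_add[of x "- x"] hom_zero by (simp add: eq_neg_iff_add_eq_0 add.commute)

lemma hom_diff: "h (x - y) = h x - h y"
  using hom_add[of x "- y"] hom_uminus by simp

lemma hom_power: "h (x ^ n) = h x ^ n"
  by (induction n) (simp_all add: hom_one hom_mult)

lemma hom_sum: "h (sum f F) = (\<Sum>x\<in>F. h (f x))"
  by (induction F rule: infinite_finite_induct) (simp_all add: hom_add hom_zero)

lemma hom_prod: "h (prod f F) = (\<Prod>x\<in>F. h (f x))"
  by (induction F rule: infinite_finite_induct) (simp_all add: hom_mult hom_one)

end

lemma unital_ring_hom_comp:
  "unital_ring_hom f \<Longrightarrow> unital_ring_hom g \<Longrightarrow> unital_ring_hom (\<lambda>x. g (f x))"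
  by (simp add: unital_ring_hom_def)

definition monomial_value :: "('v \<Rightarrow> 'b::comm_ring_1) \<Rightarrow> ('v \<Rightarrow>\<^sub>0 nat) \<Rightarrow> 'b" where
  "monomial_value \<sigma> m = (\<Prod>v\<in>Poly_Mapping.keys m. \<sigma> v ^ Poly_Mapping.lookup m v)"

text \<open>
  Evaluation of polynomials in an arbitrary commutative ring, along a homomorphism of the
  coefficients and a valuation of the variables. One construction serves for \<^const>\<open>mpoly_subst\<close>,
  for the passage from binary forms to univariate polynomials, for the homomorphisms to a field of
  fractions that eliminate the coordinates $z_j$, and for the points over the base field.
\<close>

definition mpoly_eval ::
    "('a \<Rightarrow> 'b) \<Rightarrow> ('v \<Rightarrow> 'b::comm_ring_1) \<Rightarrow> ('v, 'a::comm_ring_1) mpoly \<Rightarrow> 'b" where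
  "mpoly_eval h \<sigma> p =
     (\<Sum>m\<in>Poly_Mapping.keys p. h (Poly_Mapping.lookup p m) * monomial_value \<sigma> m)"

lemma monomial_value_superset:
  assumes "finite V" "Poly_Mapping.keys m \<subseteq> V"
  shows "monomial_value \<sigma> m = (\<Prod>v\<in>V. \<sigma> v ^ Poly_Mapping.lookup m v)"
  unfolding monomial_value_def
  by (rule prod.mono_neutral_left) (use assms in \<open>auto simp: in_keys_iff\<close>)

lemma monomial_value_add:
  "monomial_value \<sigma> (m + n) = monomial_value \<sigma> m * monomial_value \<sigma> n"
proof -
  let ?V = "Poly_Mapping.keys m \<union> Poly_Mapping.keys n"
  have "monomial_value \<sigma> l = (\<Prod>v\<in>?V. \<sigma> v ^ Poly_Mapping.lookup l v)" if "l \<in> {m, n, m + n}" for l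
    using that Poly_Mapping.keys_add[of m n] by (intro monomial_value_superset) auto
  thus ?thesis by (simp add: lookup_add power_add prod.distrib)
qed

lemma mpoly_eq_sum_single:
  "(p :: ('v, 'a::comm_ring_1) mpoly)
     = (\<Sum>m\<in>Poly_Mapping.keys p. Poly_Mapping.single m (Poly_Mapping.lookup p m))"
  by (rule poly_mapping_eqI) (auto simp: lookup_sum lookup_single when_def in_keys_iff)

lemma single_eq_monomial_value:
  "Poly_Mapping.single m c = Const c * monomial_value Var (m :: 'v \<Rightarrow>\<^sub>0 nat)"
proof -
  have "(\<Prod>v\<in>V. Poly_Mapping.single (Poly_Mapping.single v (f v)) (1::'a))
      = Poly_Mapping.single (\<Sum>v\<in>V. Poly_Mapping.single v (f v)) 1"
    for V and f :: "'v \<Rightarrow> nat"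
    by (induction V rule: infinite_finite_induct) (simp_all add: mult_single)
  moreover have "(\<Sum>v\<in>Poly_Mapping.keys m. Poly_Mapping.single v (Poly_Mapping.lookup m v)) = m"
    by (rule poly_mapping_eqI) (auto simp: lookup_sum lookup_single when_def in_keys_iff)
  ultimately show ?thesis
    by (simp add: monomial_value_def Var_power Const_def mult_single)
qed

lemma mpoly_ring_induct [consumes 1, case_names Const Var add mult]:
  assumes p: "p \<in> carrier (mpoly_ring X)"
    and C: "\<And>c. Q (Const c)" and V: "\<And>v. v \<in> X \<Longrightarrow> Q (Var v)"
    and A: "\<And>p q. Q p \<Longrightarrow> Q q \<Longrightarrow> Q (p + q)" and M: "\<And>p q. Q p \<Longrightarrow> Q q \<Longrightarrow> Q (p * q)"
  shows "Q p"
proof -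
  have one: "Q 1" using C[of 1] by (simp add: Const_def)
  have zero: "Q 0" using C[of 0] by (simp add: Const_def)
  have pow: "Q (Var v ^ n)" if "v \<in> X" for v n
    by (induction n) (auto intro: M V that one)
  have mon: "Q (\<Prod>v\<in>F. Var v ^ g v)" if "F \<subseteq> X" for F g
    using that by (induction F rule: infinite_finite_induct) (simp_all add: one M pow)
  have sum: "Q (sum f F)" if "\<And>m. m \<in> F \<Longrightarrow> Q (f m)" for f and F :: "('a \<Rightarrow>\<^sub>0 nat) set"
    using that by (induction F rule: infinite_finite_induct) (simp_all add: zero A)
  have "Q (Poly_Mapping.single m (Poly_Mapping.lookup p m))" if "m \<in> Poly_Mapping.keys p" for m
    unfolding single_eq_monomial_value monomial_value_def
    by (rule M[OF C mon]) (use that p in \<open>auto simp: mpoly_ring_def\<close>)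
  hence "Q (\<Sum>m\<in>Poly_Mapping.keys p. Poly_Mapping.single m (Poly_Mapping.lookup p m))"
    by (rule sum)
  thus ?thesis by (simp only: mpoly_eq_sum_single[symmetric])
qed

context unital_ring_hom
begin

lemma mpoly_eval_superset:
  assumes "finite M" "Poly_Mapping.keys p \<subseteq> M"
  shows "mpoly_eval h \<sigma> p = (\<Sum>m\<in>M. h (Poly_Mapping.lookup p m) * monomial_value \<sigma> m)"
  unfolding mpoly_eval_def
  by (rule sum.mono_neutral_left) (use assms in \<open>auto simp: in_keys_iff hom_zero\<close>)

lemma mpoly_eval_add: "mpoly_eval h \<sigma> (p + q) = mpoly_eval h \<sigma> p + mpoly_eval h \<sigma> q"
proof -
  let ?M = "Poly_Mapping.keys p \<union> Poly_Mapping.keys q"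
  have "mpoly_eval h \<sigma> r = (\<Sum>m\<in>?M. h (Poly_Mapping.lookup r m) * monomial_value \<sigma> m)"
    if "r \<in> {p, q, p + q}" for r
    using that Poly_Mapping.keys_add[of p q] by (intro mpoly_eval_superset) auto
  thus ?thesis by (simp add: lookup_add hom_add distrib_right sum.distrib)
qed

lemma mpoly_eval_single: "mpoly_eval h \<sigma> (Poly_Mapping.single m c) = h c * monomial_value \<sigma> m"
  by (simp add: mpoly_eval_def hom_zero)

lemma mpoly_eval_sum: "mpoly_eval h \<sigma> (sum f F) = (\<Sum>x\<in>F. mpoly_eval h \<sigma> (f x))"
  by (induction F rule: infinite_finite_induct) (simp_all add: mpoly_eval_add, simp_all add: mpoly_eval_def)

lemma mpoly_eval_hom: "unital_ring_hom (mpoly_eval h (\<sigma> :: 'v \<Rightarrow> 'b))"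
proof
  show "mpoly_eval h \<sigma> 1 = 1"
    using mpoly_eval_single[of \<sigma> 0 1] by (simp add: hom_one monomial_value_def)
  fix p q :: "('v, 'a) mpoly"
  have "p * q = (\<Sum>m\<in>Poly_Mapping.keys p. Poly_Mapping.single m (Poly_Mapping.lookup p m)) * 
     (\<Sum>n\<in>Poly_Mapping.keys q. Poly_Mapping.single n (Poly_Mapping.lookup q n))"
    by (simp only: mpoly_eq_sum_single[symmetric])
  thus "mpoly_eval h \<sigma> (p * q) = mpoly_eval h \<sigma> p * mpoly_eval h \<sigma> q"
    by (simp add: sum_product mult_single mpoly_eval_sum mpoly_eval_single monomial_value_add hom_mult)
       (simp add: mpoly_eval_def sum_product mult_ac)
qed (rule mpoly_eval_add)

lemma mpoly_eval_Const: "mpoly_eval h \<sigma> (Const c) = h c"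
  by (simp add: Const_def mpoly_eval_single monomial_value_def)

lemma mpoly_eval_Var: "mpoly_eval h \<sigma> (Var v) = \<sigma> v"
  by (simp add: Var_def mpoly_eval_single monomial_value_def hom_one)

end

lemma mpoly_subst_eq: "mpoly_subst \<sigma> = mpoly_eval Const \<sigma>"
  by (simp add: fun_eq_iff mpoly_subst_def mpoly_eval_def monomial_value_def)

lemma Const_hom: "unital_ring_hom Const"
  by unfold_locales (simp_all add: Const_add Const_mult, simp add: Const_def)

section \<open>The coefficients of the generic product\<close>

text \<open>
  Setting $x = 1$ turns the identity of binary forms that defines the $\Theta_j$ into an identity of
  univariate polynomials, without loss of information. Stating it after an arbitrary homomorphism
  $\psi$ yields at once all the specializations of the $\Theta_j$ that occur below.
\<close>

lemma hom_Theta: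
  fixes \<psi> :: "(nat \<times> nat, 'k::field) mpoly \<Rightarrow> 'b::comm_ring_1"
  assumes "unital_ring_hom \<psi>" and e: "(\<Sum>r=1..d. r * e r) = d"
  shows "(\<Sum>j=0..d. Polynomial.monom (\<psi> (Theta d e j)) j)
       = (\<Prod>r=1..d. (\<Sum>t=0..e r. Polynomial.monom (\<psi> (Var (r, t))) t) ^ r)"
proof -
  interpret unital_ring_hom \<psi> by fact
  interpret c: unital_ring_hom "\<lambda>x. [:\<psi> x:]"
    by unfold_locales (simp_all add: hom_add hom_mult hom_one)
  define E where "E = mpoly_eval (\<lambda>x. [:\<psi> x:]) (\<lambda>i::nat. if i = 0 then 1 else [:0, 1:])"
  interpret E: unital_ring_hom E unfolding E_def by (rule c.mpoly_eval_hom)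
  have m: "E (Const a * xy_monomial i j) = Polynomial.monom (\<psi> a) j" for a i j
    by (simp add: E.hom_mult E.hom_power xy_monomial_def) 
       (simp add: E_def c.mpoly_eval_Const c.mpoly_eval_Var monom_altdef)
  have "E (\<Sum>j=0..d. Const (Theta d e j) * xy_monomial (d - j) j) = E (generic_product d e)"
    by (simp add: Theta_identity[OF e])
  thus ?thesis unfolding generic_product_def
    by (simp add: E.hom_sum E.hom_prod E.hom_power m)
qed

lemma hom_theta:
  fixes \<psi> :: "(nat \<times> nat, 'k::field) mpoly \<Rightarrow> 'b::comm_ring_1"
  assumes "unital_ring_hom \<psi>" and e: "(\<Sum>r=1..d. r * e r) = d"
  shows "(\<Sum>j=0..d. Polynomial.monom (\<psi> (theta d e \<alpha> j)) j)
       = (\<Prod>r=1..d. (\<Sum>t=0..e r. Polynomial.monom (\<psi> (coord \<alpha> (r, t))) t) ^ r)"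
proof -
  interpret Const: unital_ring_hom Const by (rule Const_hom)
  have "unital_ring_hom (\<lambda>p. \<psi> (mpoly_subst (coord \<alpha>) p))"
    unfolding mpoly_subst_eq by (rule unital_ring_hom_comp[OF Const.mpoly_eval_hom assms(1)])
  from hom_Theta[OF this e] show ?thesis
    by (simp add: theta_def mpoly_subst_eq Const.mpoly_eval_Var)
qed

text \<open>
  Thus $\psi(\theta_j)$ depends on $\psi$ only through the coordinates with $r \ge 1$: this is the way
  in which the independence of $\theta_j$ from the $z_i$ is used.
\<close>

lemma coeff_hom_theta:
  fixes \<psi> :: "(nat \<times> nat, 'k::field) mpoly \<Rightarrow> 'b::comm_ring_1"
  assumes "unital_ring_hom \<psi>" and e: "(\<Sum>r=1..d. r * e r) = d" and "j \<le> d"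
  shows "\<psi> (theta d e \<alpha> j)
       = Polynomial.coeff (\<Prod>r=1..d. (\<Sum>t=0..e r. Polynomial.monom (\<psi> (coord \<alpha> (r, t))) t) ^ r) j"
  unfolding hom_theta[OF assms(1,2), symmetric] using assms(3)
  by (simp add: coeff_sum when_def)

section \<open>Ideals of polynomial rings and Gauss's lemma\<close>

lemma mpoly_ring_ops [simp]:
  "monoid.mult (mpoly_ring X) = (*)" "ring.add (mpoly_ring X) = (+)"
  "\<one>\<^bsub>mpoly_ring X\<^esub> = 1" "\<zero>\<^bsub>mpoly_ring X\<^esub> = 0"
  by (simp_all add: mpoly_ring_def)

definition coeffs_in :: "'a::zero set \<Rightarrow> 'a Polynomial.poly \<Rightarrow> bool" where
  "coeffs_in C p \<longleftrightarrow> (\<forall>i. Polynomial.coeff p i \<in> C)"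

context
  fixes X :: "'v set" and R :: "('v, 'a::comm_ring_1) mpoly ring"
  defines "R \<equiv> mpoly_ring X"
begin

interpretation cring R unfolding R_def by (rule cring_mpoly_ring)

lemma R_ops:
  "monoid.mult R = (*)" "ring.add R = (+)" "\<one>\<^bsub>R\<^esub> = 1" "\<zero>\<^bsub>R\<^esub> = 0"
  by (simp_all add: R_def)

lemma mpoly_carrier:
  "0 \<in> carrier R" "1 \<in> carrier R" "Const c \<in> carrier R" "v \<in> X \<Longrightarrow> Var v \<in> carrier R"
  "p \<in> carrier R \<Longrightarrow> q \<in> carrier R \<Longrightarrow> p + q \<in> carrier R"
  "p \<in> carrier R \<Longrightarrow> q \<in> carrier R \<Longrightarrow> p * q \<in> carrier R"
proof -
  show "p + q \<in> carrier R" "p * q \<in> carrier R" if "p \<in> carrier R" "q \<in> carrier R" for p q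
    using a_closed[OF that] m_closed[OF that] by (simp_all add: R_def)
qed (use zero_closed one_closed in \<open>simp_all add: R_def\<close>,
     simp_all add: mpoly_ring_def Const_def Var_def)

lemma mpoly_carrier_diff:
  assumes "p \<in> carrier R" "q \<in> carrier R" shows "p - q \<in> carrier R"
  using mpoly_carrier(5)[OF assms(1) mpoly_carrier(6)[OF mpoly_carrier(3)[of "-1"] assms(2)]]
  by (simp add: Const_def single_uminus)

lemma mpoly_carrier_power: "p \<in> carrier R \<Longrightarrow> p ^ n \<in> carrier R"
  by (induction n) (simp_all add: mpoly_carrier)

lemma mpoly_carrier_sum: "(\<And>i. i \<in> F \<Longrightarrow> f i \<in> carrier R) \<Longrightarrow> sum f F \<in> carrier R"
  by (induction F rule: infinite_finite_induct) (simp_all add: mpoly_carrier)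

lemma mpoly_ideal:
  assumes "ideal J R"
  shows "0 \<in> J" "p \<in> J \<Longrightarrow> q \<in> J \<Longrightarrow> p + q \<in> J" "p \<in> J \<Longrightarrow> r \<in> carrier R \<Longrightarrow> r * p \<in> J"
    "p \<in> J \<Longrightarrow> r \<in> carrier R \<Longrightarrow> p * r \<in> J" "p \<in> J \<Longrightarrow> - p \<in> J"
    "p \<in> J \<Longrightarrow> q \<in> J \<Longrightarrow> p - q \<in> J"
proof -
  interpret J: ideal J R by fact
  show "0 \<in> J" "p \<in> J \<Longrightarrow> q \<in> J \<Longrightarrow> p + q \<in> J" "p \<in> J \<Longrightarrow> r \<in> carrier R \<Longrightarrow> r * p \<in> J"
    "p \<in> J \<Longrightarrow> r \<in> carrier R \<Longrightarrow> p * r \<in> J" for p q r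
    using J.zero_closed J.a_closed[of p q] J.I_l_closed[of p r] J.I_r_closed[of p r]
    by (simp_all add: R_def)
  note * = this
  show m: "- p \<in> J" if "p \<in> J" for p
    using *(3)[OF that mpoly_carrier(3)[of "-1"]] by (simp add: Const_def single_uminus)
  show "p \<in> J \<Longrightarrow> q \<in> J \<Longrightarrow> p - q \<in> J"
    using *(2)[of p "- q"] m[of q] by simp
qed

lemma mpoly_ideal_sum:
  assumes "ideal J R" "\<And>i. i \<in> F \<Longrightarrow> f i \<in> J" shows "sum f F \<in> J"
  using assms(2) by (induction F rule: infinite_finite_induct) (simp_all add: mpoly_ideal[OF assms(1)])

lemma kernel_is_ideal:
  assumes "unital_ring_hom \<psi>" shows "ideal {p \<in> carrier R. \<psi> p = 0} R"
proof -
  interpret unital_ring_hom \<psi> by fact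
  show ?thesis
  proof (rule idealI)
    show "subgroup {p \<in> carrier R. \<psi> p = 0} (add_monoid R)"
    proof (rule add.subgroupI)
      fix p assume "p \<in> {p \<in> carrier R. \<psi> p = 0}"
      moreover from this have "\<ominus>\<^bsub>R\<^esub> p = - p"
        using mpoly_carrier_diff[OF mpoly_carrier(1)] by (intro minus_equality) (auto simp: R_def)
      ultimately show "\<ominus>\<^bsub>R\<^esub> p \<in> {p \<in> carrier R. \<psi> p = 0}"
        using mpoly_carrier_diff[OF mpoly_carrier(1)] by (auto simp: hom_uminus)
    qed (use mpoly_carrier hom_zero in \<open>auto simp: R_def hom_add\<close>)
  qed (auto simp: ring_axioms hom_mult mpoly_carrier R_ops)
qed

lemma coeffs_in_1: "coeffs_in (carrier R) 1"
  by (simp add: coeffs_in_def mpoly_carrier when_def)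

lemma coeffs_in_mult: "coeffs_in (carrier R) p \<Longrightarrow> coeffs_in (carrier R) q \<Longrightarrow> coeffs_in (carrier R) (p * q)"
  by (simp add: coeffs_in_def Polynomial.coeff_mult mpoly_carrier mpoly_carrier_sum)

lemma coeffs_in_power: "coeffs_in (carrier R) p \<Longrightarrow> coeffs_in (carrier R) (p ^ n)"
  by (induction n) (simp_all add: coeffs_in_1 coeffs_in_mult)

lemma coeffs_in_prod:
  "(\<And>r. r \<in> F \<Longrightarrow> coeffs_in (carrier R) (f r)) \<Longrightarrow> coeffs_in (carrier R) (prod f F)"
  by (induction F rule: infinite_finite_induct) (simp_all add: coeffs_in_1 coeffs_in_mult)

text \<open>
  Gauss's lemma: modulo $P$, the product of the lowest surviving terms of the two factors survives.
\<close>

lemma content_mult_avoids_prime: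
  assumes P: "primeideal P R"
    and p: "coeffs_in (carrier R) p" "\<exists>i. Polynomial.coeff p i \<notin> P"
    and q: "coeffs_in (carrier R) q" "\<exists>i. Polynomial.coeff q i \<notin> P"
  shows "\<exists>i. Polynomial.coeff (p * q) i \<notin> P"
proof -
  interpret P: primeideal P R by fact
  let ?c = Polynomial.coeff
  define m where "m = (LEAST i. ?c p i \<notin> P)"
  define n where "n = (LEAST i. ?c q i \<notin> P)"
  have m: "?c p m \<notin> P" unfolding m_def using p(2) by (rule LeastI_ex)
  have n: "?c q n \<notin> P" unfolding n_def using q(2) by (rule LeastI_ex)
  have below: "?c p i \<in> P" if "i < m" for i
    using not_less_Least[of i "\<lambda>i. ?c p i \<notin> P"] that by (auto simp: m_def)
  have below': "?c q i \<in> P" if "i < n" for i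
    using not_less_Least[of i "\<lambda>i. ?c q i \<notin> P"] that by (auto simp: n_def)
  have rest: "(\<Sum>i\<in>{..m + n} - {m}. ?c p i * ?c q (m + n - i)) \<in> P"
  proof (rule mpoly_ideal_sum[OF P.ideal_axioms])
    fix i assume i: "i \<in> {..m + n} - {m}"
    show "?c p i * ?c q (m + n - i) \<in> P"
    proof (cases "i < m")
      case True
      thus ?thesis using below q(1) by (auto simp: coeffs_in_def intro: mpoly_ideal(4)[OF P.ideal_axioms])
    next
      case False
      with i have "m + n - i < n" by auto
      thus ?thesis using below' p(1) by (auto simp: coeffs_in_def intro: mpoly_ideal(3)[OF P.ideal_axioms])
    qed
  qed
  have "?c (p * q) (m + n) = ?c p m * ?c q n + (\<Sum>i\<in>{..m + n} - {m}. ?c p i * ?c q (m + n - i))"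
    unfolding Polynomial.coeff_mult by (subst sum.remove[of _ m]) auto
  moreover have "?c p m * ?c q n \<notin> P"
    using P.I_prime[of "?c p m" "?c q n"] m n p(1) q(1) by (auto simp: coeffs_in_def R_def)
  ultimately have "?c (p * q) (m + n) \<notin> P"
    using mpoly_ideal(6)[OF P.ideal_axioms _ rest, of "?c (p * q) (m + n)"] by auto
  thus ?thesis ..
qed

lemma content_prod_power_avoids_prime:
  assumes P: "primeideal P R"
    and f: "\<And>r. r \<in> F \<Longrightarrow> coeffs_in (carrier R) (f r)" "\<And>r. r \<in> F \<Longrightarrow> \<exists>i. Polynomial.coeff (f r) i \<notin> P"
  shows "\<exists>i. Polynomial.coeff (\<Prod>r\<in>F. f r ^ k r) i \<notin> P"
proof -
  interpret P: primeideal P R by fact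
  have "1 \<notin> P" using P.I_notcarr P.one_imp_carrier by (auto simp: R_def)
  hence one: "\<exists>i. Polynomial.coeff (1 :: ('v, 'a) mpoly Polynomial.poly) i \<notin> P"
    by (intro exI[of _ 0]) simp
  have pow: "\<exists>i. Polynomial.coeff (f r ^ n) i \<notin> P" if r: "r \<in> F" for r n
  proof (induction n)
    case 0
    show ?case unfolding power_0 by (rule one)
  next
    case (Suc n)
    show ?case unfolding power_Suc
      by (rule content_mult_avoids_prime[OF P]) (intro f coeffs_in_power r Suc)+
  qed
  show ?thesis using f(1) pow
  proof (induction F rule: infinite_finite_induct)
    case (insert r F)
    show ?case unfolding prod.insert[OF insert.hyps]
      by (rule content_mult_avoids_prime[OF P])
         (use insert in \<open>simp_all add: coeffs_in_power coeffs_in_prod\<close>)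
  next
    case (infinite F)
    show ?case unfolding prod.infinite[OF infinite(1)] by (rule one)
  next
    case empty
    show ?case unfolding prod.empty by (rule one)
  qed
qed

end



section \<open>Units modulo an ideal and regular sequences in local rings\<close>

context cring
begin

text \<open>
  By Zorn's lemma there is an ideal that is maximal among those containing $I$ but not $1$.
\<close>

lemma proper_ideal_le_primeideal:
  assumes I: "ideal I R" "\<one> \<notin> I"
  obtains P where "primeideal P R" "I \<subseteq> P"
proof -
  let ?S = "{J. ideal J R \<and> I \<subseteq> J \<and> \<one> \<notin> J}"
  have "\<exists>M\<in>?S. \<forall>J\<in>?S. M \<subseteq> J \<longrightarrow> J = M"
  proof (rule subset_Zorn_nonempty)
    show "?S \<noteq> {}" using I by blast
    fix C assume C: "C \<noteq> {}" "subset.chain ?S C"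
    hence "subset.chain {J. ideal J R} C" by (auto simp: subset_chain_def)
    from chain_Union_is_ideal[OF this] C(1) have "ideal (\<Union>C) R" by simp
    thus "\<Union>C \<in> ?S" using C by (auto simp: subset_chain_def)
  qed
  then obtain M where "M \<in> ?S" and "\<forall>J\<in>?S. M \<subseteq> J \<longrightarrow> J = M" ..
  hence M: "ideal M R" "I \<subseteq> M" "\<one> \<notin> M"
    and max: "\<And>J. ideal J R \<Longrightarrow> I \<subseteq> J \<Longrightarrow> \<one> \<notin> J \<Longrightarrow> M \<subseteq> J \<Longrightarrow> J = M" by simp_all
  have "maximalideal M R"
  proof (rule maximalidealI[OF M(1)])
    show "carrier R \<noteq> M" using M(3) by auto
    fix J assume J: "ideal J R" "M \<subseteq> J" "J \<subseteq> carrier R"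
    show "J = M \<or> J = carrier R"
      using max[OF J(1) order.trans[OF M(2) J(2)] _ J(2)] ideal.one_imp_carrier[OF J(1)] by blast
  qed
  from that[OF maximalideal_prime[OF this] M(2)] show ?thesis .
qed

text \<open>
  If $x$ lies in no prime containing $I$, then no prime contains $I + (x)$, so $1 = i + rx$
  with $i \in I$ and the coset of $r$ is an inverse.
\<close>

lemma coset_Units_if_avoids_primes:
  assumes I: "ideal I R" and x: "x \<in> carrier R"
    and avoid: "\<And>P. primeideal P R \<Longrightarrow> I \<subseteq> P \<Longrightarrow> x \<notin> P"
  shows "I +> x \<in> Units (R Quot I)"
proof -
  interpret I: ideal I R by fact
  have sum: "ideal (I <+>\<^bsub>R\<^esub> PIdl x) R" by (rule add_ideals[OF I cgenideal_ideal[OF x]])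
  have "I \<union> PIdl x \<subseteq> carrier R"
    using I.Icarr ideal.Icarr[OF cgenideal_ideal[OF x]] by auto
  hence sub: "I \<union> PIdl x \<subseteq> I <+>\<^bsub>R\<^esub> PIdl x"
    using genideal_self by (simp only: union_genideal[OF I cgenideal_ideal[OF x], symmetric])
  have "\<one> \<in> I <+>\<^bsub>R\<^esub> PIdl x"
  proof (rule ccontr)
    assume "\<one> \<notin> I <+>\<^bsub>R\<^esub> PIdl x"
    from proper_ideal_le_primeideal[OF sum this]
    obtain P where P: "primeideal P R" "I <+>\<^bsub>R\<^esub> PIdl x \<subseteq> P" .
    have "I \<subseteq> P" "x \<in> P" using P(2) sub cgenideal_self[OF x] by auto
    with avoid[OF P(1)] show False by simp
  qed
  then obtain i r where ir: "i \<in> I" "r \<in> carrier R" "\<one> = i \<oplus> r \<otimes> x"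
    by (auto simp: set_add_def' cgenideal_def)
  have "\<one> \<ominus> r \<otimes> x = i"
    using ir x I.Icarr[OF ir(1)] by (simp add: ir(3) minus_eq a_assoc r_neg)
  with ir(1) have "\<one> \<ominus> r \<otimes> x \<in> I" by simp
  hence "I +> \<one> = I +> (r \<otimes> x)"
    using quotient_eq_iff_same_a_r_cos[OF I one_closed m_closed[OF ir(2) x]] by simp
  moreover have "(I +> r) \<otimes>\<^bsub>R Quot I\<^esub> (I +> x) = I +> (r \<otimes> x)"
    "(I +> x) \<otimes>\<^bsub>R Quot I\<^esub> (I +> r) = I +> (r \<otimes> x)"
    using I.rcoset_mult_add ir(2) x by (simp_all add: FactRing_def m_comm)
  moreover have "I +> r \<in> carrier (R Quot I)" "I +> x \<in> carrier (R Quot I)"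
    using ir(2) x by (auto simp: FactRing_simps)
  ultimately show ?thesis
    by (auto simp: Units_def FactRing_def)
qed

text \<open>
  This removes cosets from regular sequences, leaving a condition on membership in ideals.
\<close>

lemma nonzerodivisor_coset_iff:
  assumes J: "ideal J R" and f: "f \<in> carrier R"
  shows "nonzerodivisor (R Quot J) (J +> f) \<longleftrightarrow> (\<forall>x\<in>carrier R. f \<otimes> x \<in> J \<longrightarrow> x \<in> J)"
proof -
  interpret J: ideal J R by fact
  have coset: "J +> y = J \<longleftrightarrow> y \<in> J" if "y \<in> carrier R" for y
    using J.a_rcos_const[of y] J.a_rcos_self[OF that] by auto
  have "J +> f \<in> carrier (R Quot J)"
    using f by (auto simp: FactRing_simps)
  moreover have "carrier (R Quot J) = (\<lambda>x. J +> x) ` carrier R"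
    by (auto simp: FactRing_simps)
  ultimately show ?thesis
    using f J.rcoset_mult_add[OF f]
    by (simp add: nonzerodivisor_def FactRing_def coset)
qed

context
  fixes P assumes P: "primeideal P R"
begin

interpretation P: primeideal P R by (rule P)

lemma prime_complement:
  "carrier R - P \<subseteq> carrier R" "\<one> \<in> carrier R - P"
  "\<And>s t. s \<in> carrier R - P \<Longrightarrow> t \<in> carrier R - P \<Longrightarrow> s \<otimes> t \<in> carrier R - P"
  using P.I_prime P.I_notcarr P.one_imp_carrier by auto

lemma local_ring_fraction_eq_iff:
  assumes "a \<in> carrier R" "b \<in> carrier R" "s \<in> carrier R - P" "t \<in> carrier R - P"
  shows "fraction R (carrier R - P) a s = fraction R (carrier R - P) b t
    \<longleftrightarrow> (\<exists>u\<in>carrier R - P. u \<otimes> (a \<otimes> t) = u \<otimes> (b \<otimes> s))"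
  by (rule fraction_eq_iff) (rule prime_complement assms | assumption)+

lemma local_ring_mult:
  assumes "a \<in> carrier R" "s \<in> carrier R - P" "b \<in> carrier R" "t \<in> carrier R - P"
  shows "fraction R (carrier R - P) a s \<otimes>\<^bsub>local_ring_at R P\<^esub> fraction R (carrier R - P) b t
    = fraction R (carrier R - P) (a \<otimes> b) (s \<otimes> t)"
  unfolding local_ring_at_def
  by (rule localization_mult) (rule prime_complement assms | assumption)+

lemma local_ring_add:
  assumes "a \<in> carrier R" "s \<in> carrier R - P" "b \<in> carrier R" "t \<in> carrier R - P"
  shows "fraction R (carrier R - P) a s \<oplus>\<^bsub>local_ring_at R P\<^esub> fraction R (carrier R - P) b t
    = fraction R (carrier R - P) (a \<otimes> t \<oplus> b \<otimes> s) (s \<otimes> t)"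
  unfolding local_ring_at_def
  by (rule localization_add) (rule prime_complement assms | assumption)+

lemma local_ring_carrier:
  "a \<in> carrier R \<Longrightarrow> s \<in> carrier R - P \<Longrightarrow>
    fraction R (carrier R - P) a s \<in> carrier (local_ring_at R P)"
  unfolding local_ring_at_def localization_def by auto

lemma germ_hom: "germ R P \<in> ring_hom R (local_ring_at R P)"
proof (rule ring_hom_memI)
  fix x y assume xy: "x \<in> carrier R" "y \<in> carrier R"
  show "germ R P x \<in> carrier (local_ring_at R P)"
    unfolding germ_def by (intro local_ring_carrier xy prime_complement)
  have "germ R P x \<otimes>\<^bsub>local_ring_at R P\<^esub> germ R P y
      = fraction R (carrier R - P) (x \<otimes> y) (\<one> \<otimes> \<one>)"
    unfolding germ_def by (intro local_ring_mult xy prime_complement)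
  thus "germ R P (x \<otimes> y) = germ R P x \<otimes>\<^bsub>local_ring_at R P\<^esub> germ R P y"
    by (simp add: germ_def)
  have "germ R P x \<oplus>\<^bsub>local_ring_at R P\<^esub> germ R P y
      = fraction R (carrier R - P) (x \<otimes> \<one> \<oplus> y \<otimes> \<one>) (\<one> \<otimes> \<one>)"
    unfolding germ_def by (intro local_ring_add xy prime_complement)
  thus "germ R P (x \<oplus> y) = germ R P x \<oplus>\<^bsub>local_ring_at R P\<^esub> germ R P y"
    using xy by (simp add: germ_def)
qed (simp add: germ_def local_ring_at_def localization_def)

text \<open>
  Denominators can be cleared: a fraction is in the extension of an ideal to the local ring exactly if
  some multiple of its numerator by an element outside $P$ is in the ideal itself.
\<close>

lemma mem_genideal_germs_iff:
  assumes F: "F \<subseteq> carrier R" and x: "x \<in> carrier R" "s \<in> carrier R - P"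
  shows "fraction R (carrier R - P) x s \<in> genideal (local_ring_at R P) (germ R P ` F)
     \<longleftrightarrow> (\<exists>u\<in>carrier R - P. u \<otimes> x \<in> Idl F)"
proof -
  let ?L = "local_ring_at R P" and ?S = "carrier R - P"
  let ?G = "genideal ?L (germ R P ` F)"
  interpret L: cring ?L by (rule cring_local_ring_at[OF P])
  interpret h: ring_hom_ring R ?L "germ R P"
    by (intro ring_hom_ringI2 germ_hom ring_axioms L.ring_axioms)
  interpret J: ideal "Idl F" R by (rule genideal_ideal[OF F])
  have FL: "germ R P ` F \<subseteq> carrier ?L" using F by auto
  interpret G: ideal ?G ?L by (rule L.genideal_ideal[OF FL])
  \<comment> \<open>The extended ideal consists of the fractions with numerator in the ideal.\<close>
  define M where "M = {fraction R ?S a t | a t. a \<in> Idl F \<and> t \<in> ?S}"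
  have MI: "fraction R ?S a t \<in> M" if "a \<in> Idl F" "t \<in> ?S" for a t
    using that unfolding M_def by blast
  have "ideal M ?L"
  proof (rule idealI)
    show "ring ?L" by (rule L.ring_axioms)
    show "subgroup M (add_monoid ?L)"
    proof
      show "M \<subseteq> carrier (add_monoid ?L)" by (auto simp: M_def intro!: local_ring_carrier J.Icarr)
      show "\<one>\<^bsub>add_monoid ?L\<^esub> \<in> M"
        using MI[OF J.zero_closed prime_complement(2)]
        by (simp add: local_ring_at_def localization_def)
    next
      fix X Y assume "X \<in> M" "Y \<in> M"
      then obtain a t b r where X: "a \<in> Idl F" "t \<in> ?S" "X = fraction R ?S a t"
        and Y: "b \<in> Idl F" "r \<in> ?S" "Y = fraction R ?S b r" by (auto simp: M_def)
      have "X \<oplus>\<^bsub>?L\<^esub> Y = fraction R ?S (a \<otimes> r \<oplus> b \<otimes> t) (t \<otimes> r)"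
        unfolding X(3) Y(3) by (intro local_ring_add J.Icarr X Y)
      moreover have "a \<otimes> r \<oplus> b \<otimes> t \<in> Idl F"
        using X Y by (intro J.a_closed J.I_r_closed) auto
      ultimately show "X \<otimes>\<^bsub>add_monoid ?L\<^esub> Y \<in> M"
        using prime_complement(3)[OF X(2) Y(2)] by (auto simp: M_def)
    next
      fix X assume "X \<in> M"
      then obtain a t where X: "a \<in> Idl F" "t \<in> ?S" "X = fraction R ?S a t"
        by (auto simp: M_def)
      note t = X(2)[THEN DiffD1] and a = J.Icarr[OF X(1)]
      have "fraction R ?S (\<ominus> a) t \<oplus>\<^bsub>?L\<^esub> X = fraction R ?S (\<ominus> a \<otimes> t \<oplus> a \<otimes> t) (t \<otimes> t)"
        unfolding X(3) by (intro local_ring_add a a_inv_closed X)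
      also have "\<ominus> a \<otimes> t \<oplus> a \<otimes> t = \<zero>"
        using a t by (simp add: l_minus l_neg)
      also have "fraction R ?S \<zero> (t \<otimes> t) = \<zero>\<^bsub>?L\<^esub>"
        using local_ring_fraction_eq_iff[of \<zero> \<zero> "t \<otimes> t" \<one>] prime_complement(3)[OF X(2) X(2)]
          prime_complement(2) t
        by (auto simp: local_ring_at_def localization_def)
      finally have "\<ominus>\<^bsub>?L\<^esub> X = fraction R ?S (\<ominus> a) t"
        unfolding X(3) using local_ring_carrier[OF a X(2)] local_ring_carrier[OF a_inv_closed[OF a] X(2)]
        by (intro L.minus_equality)
      hence "\<ominus>\<^bsub>?L\<^esub> X \<in> M"
        using MI[OF J.a_inv_closed[OF X(1)] X(2)] by simp
      thus "inv\<^bsub>add_monoid ?L\<^esub> X \<in> M"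
        by (simp only: a_inv_def)
    qed
  next
    fix X Y assume X: "X \<in> M" and Y: "Y \<in> carrier ?L"
    from X obtain a t where X: "a \<in> Idl F" "t \<in> ?S" "X = fraction R ?S a t"
      by (auto simp: M_def)
    from Y obtain b r where Y: "b \<in> carrier R" "r \<in> ?S" "Y = fraction R ?S b r"
      by (auto simp: local_ring_at_def localization_def)
    have "Y \<otimes>\<^bsub>?L\<^esub> X = fraction R ?S (b \<otimes> a) (r \<otimes> t)"
      unfolding X(3) Y(3) by (intro local_ring_mult J.Icarr X Y)
    thus 1: "Y \<otimes>\<^bsub>?L\<^esub> X \<in> M"
      using prime_complement(3)[OF Y(2) X(2)] J.I_l_closed[OF X(1) Y(1)] by (auto simp: M_def)
    have "X \<in> carrier ?L" "Y \<in> carrier ?L"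
      unfolding X(3) Y(3) by (intro local_ring_carrier J.Icarr X Y)+
    with 1 show "X \<otimes>\<^bsub>?L\<^esub> Y \<in> M"
      by (simp add: L.m_comm)
  qed
  moreover have "germ R P ` F \<subseteq> M"
    using genideal_self[OF F] prime_complement(2) by (auto simp: M_def germ_def)
  ultimately have GM: "?G \<subseteq> M" by (rule L.genideal_minimal)
  have "ideal {r \<in> carrier R. germ R P r \<in> ?G} R"
    by (rule h.ideal_vimage[OF G.ideal_axioms])
  moreover have "F \<subseteq> {r \<in> carrier R. germ R P r \<in> ?G}"
    using F L.genideal_self[OF FL] by auto
  ultimately have JG: "Idl F \<subseteq> {r \<in> carrier R. germ R P r \<in> ?G}"
    by (rule genideal_minimal)
  show ?thesis
  proof
    assume "fraction R ?S x s \<in> ?G"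
    then obtain a t where a: "a \<in> Idl F" "t \<in> ?S" "fraction R ?S x s = fraction R ?S a t"
      using GM by (auto simp: M_def)
    then obtain u where u: "u \<in> ?S" "u \<otimes> (x \<otimes> t) = u \<otimes> (a \<otimes> s)"
      using local_ring_fraction_eq_iff[OF x(1) J.Icarr[OF a(1)] x(2) a(2)] by blast
    have "(u \<otimes> t) \<otimes> x = u \<otimes> (a \<otimes> s)"
      using u a(2) x by (simp add: m_ac flip: u(2))
    also have "\<dots> \<in> Idl F"
      using u(1) x(2) a(1) by (intro J.I_l_closed J.I_r_closed) auto
    finally show "\<exists>u\<in>?S. u \<otimes> x \<in> Idl F"
      using prime_complement(3)[OF u(1) a(2)] by blast
  next
    assume "\<exists>u\<in>?S. u \<otimes> x \<in> Idl F"
    then obtain u where u: "u \<in> ?S" "u \<otimes> x \<in> Idl F" by blast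
    have us: "u \<otimes> s \<in> ?S" by (rule prime_complement(3)[OF u(1) x(2)])
    have car: "u \<in> carrier R" "s \<in> carrier R" using u(1) x(2) by auto
    have "germ R P (u \<otimes> x) \<otimes>\<^bsub>?L\<^esub> fraction R ?S \<one> (u \<otimes> s)
        = fraction R ?S (u \<otimes> x \<otimes> \<one>) (\<one> \<otimes> (u \<otimes> s))"
      unfolding germ_def using x(1) car us prime_complement(2) by (intro local_ring_mult) auto
    also have "\<dots> = fraction R ?S x s"
      using x car us prime_complement(2) 
      by (subst local_ring_fraction_eq_iff) (auto intro!: bexI[of _ \<one>] simp: m_ac)
    finally show "fraction R ?S x s \<in> ?G"
      using G.I_r_closed[of "germ R P (u \<otimes> x)" "fraction R ?S \<one> (u \<otimes> s)"] JG u(2)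
        local_ring_carrier[OF one_closed us] by auto
  qed
qed

text \<open>
  Regularity of a sequence of germs at $P$, expressed without reference to the local ring: cancellation
  of \<^term>\<open>fs ! i\<close> modulo its predecessors is only required up to factors outside $P$.
\<close>

lemma regular_sequence_germs:
  assumes fs: "set fs \<subseteq> P"
    and step: "\<And>i x s. i < length fs \<Longrightarrow> x \<in> carrier R \<Longrightarrow> s \<in> carrier R - P \<Longrightarrow>
      s \<otimes> (fs ! i \<otimes> x) \<in> Idl (set (take i fs)) \<Longrightarrow>
      \<exists>u\<in>carrier R - P. u \<otimes> x \<in> Idl (set (take i fs))"
  shows "regular_sequence (local_ring_at R P) (map (germ R P) fs)"
proof -
  let ?L = "local_ring_at R P" and ?S = "carrier R - P"
  interpret L: cring ?L by (rule cring_local_ring_at[OF P])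
  have fsR: "set fs \<subseteq> carrier R" using fs P.Icarr by blast
  have germ: "germ R P ` F \<subseteq> carrier ?L" if "F \<subseteq> carrier R" for F
    using that ring_hom_closed[OF germ_hom] by blast
  have "nonzerodivisor (?L Quot genideal ?L (set (take i (map (germ R P) fs))))
      (genideal ?L (set (take i (map (germ R P) fs))) +>\<^bsub>?L\<^esub> (map (germ R P) fs ! i))"
    if i: "i < length fs" for i
  proof -
    let ?F = "set (take i fs)"
    have F: "?F \<subseteq> carrier R" using fsR set_take_subset[of i fs] by blast
    have fi: "fs ! i \<in> carrier R" using fsR i nth_mem[of i fs] by blast
    have img: "set (take i (map (germ R P) fs)) = germ R P ` ?F"
      by (simp add: take_map)
    have "X \<in> genideal ?L (germ R P ` ?F)"
      if X: "X \<in> carrier ?L" "germ R P (fs ! i) \<otimes>\<^bsub>?L\<^esub> X \<in> genideal ?L (germ R P ` ?F)" for X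
    proof -
      obtain x s where x: "x \<in> carrier R" "s \<in> ?S" "X = fraction R ?S x s"
        using X(1) by (auto simp: local_ring_at_def localization_def)
      have "germ R P (fs ! i) \<otimes>\<^bsub>?L\<^esub> X = fraction R ?S (fs ! i \<otimes> x) (\<one> \<otimes> s)"
        unfolding germ_def x(3) by (intro local_ring_mult fi x prime_complement)
      hence "\<exists>u\<in>?S. u \<otimes> (fs ! i \<otimes> x) \<in> Idl ?F"
        using X(2) mem_genideal_germs_iff[OF F, of "fs ! i \<otimes> x" s] fi x by simp
      hence "\<exists>u\<in>?S. u \<otimes> x \<in> Idl ?F"
        using step[OF i x(1)] by blast
      thus ?thesis using mem_genideal_germs_iff[OF F x(1,2)] x(3) by simp
    qed
    thus ?thesis unfolding img
      using i fi ring_hom_closed[OF germ_hom fi]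
      by (subst L.nonzerodivisor_coset_iff) (auto intro!: L.genideal_ideal germ F)
  qed
  moreover have "genideal ?L (germ R P ` set fs) \<noteq> carrier ?L"
  proof
    assume "genideal ?L (germ R P ` set fs) = carrier ?L"
    hence "fraction R ?S \<one> \<one> \<in> genideal ?L (germ R P ` set fs)"
      using local_ring_carrier[OF one_closed prime_complement(2)] by simp
    then obtain u where "u \<in> ?S" "u \<otimes> \<one> \<in> Idl (set fs)"
      using mem_genideal_germs_iff[OF fsR, of \<one> \<one>] prime_complement(2) by auto
    thus False using genideal_minimal[OF P.ideal_axioms fs] by auto
  qed
  ultimately show ?thesis
    using germ[OF fsR] by (simp add: regular_sequence_def Let_def)
qed

end
end

section \<open>The equations of the graph\<close>

lemma id_hom: "unital_ring_hom (\<lambda>x. x)"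
  by unfold_locales simp_all

lemma to_fract_hom: "unital_ring_hom to_fract"
  by unfold_locales simp_all

lemma hom_theta_cong:
  fixes \<psi> \<psi>' :: "(nat \<times> nat, 'k::field) mpoly \<Rightarrow> 'b::comm_ring_1"
  assumes "unital_ring_hom \<psi>" "unital_ring_hom \<psi>'" "(\<Sum>r=1..d. r * e r) = d" "j \<le> d"
    and "\<And>r t. r \<in> {1..d} \<Longrightarrow> t \<le> e r \<Longrightarrow> \<psi> (coord \<alpha> (r, t)) = \<psi>' (coord \<alpha> (r, t))"
  shows "\<psi> (theta d e \<alpha> j) = \<psi>' (theta d e \<alpha> j)"
  using assms(5)
  unfolding coeff_hom_theta[OF assms(1,3,4)] coeff_hom_theta[OF assms(2,3,4)] by simp

definition graph_equation ::
    "nat \<Rightarrow> (nat \<Rightarrow> nat) \<Rightarrow> (nat \<Rightarrow> nat) \<Rightarrow> nat \<Rightarrow> (nat \<times> nat, 'k::field) mpoly" where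
  "graph_equation d e \<alpha> j = theta d e \<alpha> (\<alpha> 0) * z_coord \<alpha> j - theta d e \<alpha> j"

lemma graph_equations_eq:
  "graph_equations d e \<alpha> = map (graph_equation d e \<alpha>) (filter (\<lambda>j. j \<noteq> \<alpha> 0) [0..<Suc d])"
  unfolding graph_equations_def by (rule map_cong) (simp_all add: graph_equation_def)

lemma set_graph_equations:
  "set (graph_equations d e \<alpha>) = graph_equation d e \<alpha> ` {j. j \<le> d \<and> j \<noteq> \<alpha> 0}"
  by (auto simp: graph_equations_eq simp del: upt_Suc)

text \<open>
  The $r$-th normalized form $\sum_t w_{r,t}x^{e_r-t}y^t$ at $x = 1$.
\<close>

definition chart_form ::
    "(nat \<Rightarrow> nat) \<Rightarrow> (nat \<Rightarrow> nat) \<Rightarrow> nat \<Rightarrow> (nat \<times> nat, 'k::field) mpoly Polynomial.poly" where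
  "chart_form e \<alpha> r = (\<Sum>t=0..e r. Polynomial.monom (coord \<alpha> (r, t)) t)"

lemma coeff_chart_form:
  "Polynomial.coeff (chart_form e \<alpha> r) t = (if t \<le> e r then coord \<alpha> (r, t) else 0)"
  by (simp add: chart_form_def Polynomial.coeff_sum when_def)

lemma coeff_prod_chart_forms:
  assumes "(\<Sum>r=1..d. r * e r) = d"
  shows "Polynomial.coeff (\<Prod>r=1..d. chart_form e \<alpha> r ^ r) j = (if j \<le> d then theta d e \<alpha> j else 0)"
  unfolding chart_form_def hom_theta[OF id_hom assms, symmetric]
  by (simp add: Polynomial.coeff_sum when_def)

context
  fixes d :: nat and e \<alpha> :: "nat \<Rightarrow> nat" and A :: "(nat \<times> nat, 'k::field) mpoly ring"
  assumes e: "(\<Sum>r=1..d. r * e r) = d" and \<alpha>: "\<alpha> \<in> Lam d e"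
  defines "A \<equiv> chart_ring d e \<alpha>"
begin

interpretation cring A
  unfolding A_def chart_ring_def by (rule cring_mpoly_ring)

private abbreviation (input) th where "th \<equiv> (theta d e \<alpha> :: nat \<Rightarrow> (nat \<times> nat, 'k) mpoly)"
private abbreviation (input) g where "g \<equiv> (graph_equation d e \<alpha> :: nat \<Rightarrow> (nat \<times> nat, 'k) mpoly)"

lemma alpha_le: "\<alpha> 0 \<le> d" "r \<in> {1..d} \<Longrightarrow> \<alpha> r \<le> e r"
  using \<alpha> by (auto simp: Lam_def e_ext_def PiE_def Pi_def split: if_splits)

lemmas A_eq = A_def[unfolded chart_ring_def]
lemmas A_carrier = mpoly_carrier[where X = "chart_vars d e \<alpha>" and 'a = 'k, folded A_eq]
lemmas A_diff = mpoly_carrier_diff[where X = "chart_vars d e \<alpha>" and 'a = 'k, folded A_eq]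
lemmas A_power = mpoly_carrier_power[where X = "chart_vars d e \<alpha>" and 'a = 'k, folded A_eq]
lemmas A_ideal = mpoly_ideal[where X = "chart_vars d e \<alpha>" and 'a = 'k, folded A_eq]

lemma coord_in_A: "r \<le> d \<Longrightarrow> t \<le> e_ext d e r \<Longrightarrow> coord \<alpha> (r, t) \<in> carrier A"
  by (auto simp: coord_def A_carrier chart_vars_def)

lemma z_in_A: "j \<le> d \<Longrightarrow> z_coord \<alpha> j \<in> carrier A"
  by (rule coord_in_A) (simp_all add: e_ext_def)

lemma chart_form_in_A: "r \<in> {1..d} \<Longrightarrow> coeffs_in (carrier A) (chart_form e \<alpha> r)"
  by (auto simp: coeffs_in_def coeff_chart_form A_carrier e_ext_def intro!: coord_in_A)

lemma theta_in_A: "j \<le> d \<Longrightarrow> th j \<in> carrier A"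
proof -
  assume j: "j \<le> d"
  have "coeffs_in (carrier A) (\<Prod>r=1..d. chart_form e \<alpha> r ^ r :: (nat \<times> nat, 'k) mpoly Polynomial.poly)"
    unfolding A_eq
    by (intro coeffs_in_prod coeffs_in_power) (use chart_form_in_A in \<open>auto simp: A_eq\<close>)
  hence "Polynomial.coeff (\<Prod>r=1..d. chart_form e \<alpha> r ^ r) j \<in> carrier A"
    unfolding coeffs_in_def ..
  thus ?thesis using j by (simp only: coeff_prod_chart_forms[OF e] if_True)
qed

lemma graph_equation_in_A: "j \<le> d \<Longrightarrow> g j \<in> carrier A"
  unfolding graph_equation_def
  by (intro A_diff A_carrier(6) theta_in_A z_in_A alpha_le)

text \<open>
  If $\theta_{\alpha_0}$ were in $P$, the equations would put every $\theta_j$ in $P$. These are the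
  coefficients of the product of the forms, each of which has the coefficient $1$ at position
  $\alpha_r$; so this would contradict Gauss's lemma.
\<close>

lemma theta_not_in_prime:
  assumes P: "primeideal P A" and gP: "\<And>j. j \<le> d \<Longrightarrow> j \<noteq> \<alpha> 0 \<Longrightarrow> g j \<in> P"
  shows "th (\<alpha> 0) \<notin> P"
proof
  interpret P: primeideal P A by fact
  assume th: "th (\<alpha> 0) \<in> P"
  have "th j \<in> P" if j: "j \<le> d" for j
  proof (cases "j = \<alpha> 0")
    case False
    have "th (\<alpha> 0) * z_coord \<alpha> j - g j \<in> P"
      by (intro A_ideal[OF P.ideal_axioms] th z_in_A gP j False)
    thus ?thesis by (simp add: graph_equation_def)
  qed (use th in simp)
  hence "Polynomial.coeff (\<Prod>r=1..d. chart_form e \<alpha> r ^ r) i \<in> P" for i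
    using A_ideal(1)[OF P.ideal_axioms] unfolding coeff_prod_chart_forms[OF e] by simp
  moreover have "\<exists>i. Polynomial.coeff (\<Prod>r=1..d. chart_form e \<alpha> r ^ r) i \<notin> P"
  proof (rule content_prod_power_avoids_prime[OF P[unfolded A_eq]])
    fix r assume r: "r \<in> {1..d}"
    show "coeffs_in (carrier (mpoly_ring (chart_vars d e \<alpha>)))
        (chart_form e \<alpha> r :: (nat \<times> nat, 'k) mpoly Polynomial.poly)"
      using chart_form_in_A[OF r] by (simp add: A_eq)
    have "1 \<notin> P"
      using P.I_notcarr P.one_imp_carrier by (auto simp: A_eq)
    thus "\<exists>i. Polynomial.coeff (chart_form e \<alpha> r) i \<notin> P"
      by (intro exI[of _ "\<alpha> r"]) (simp add: coeff_chart_form alpha_le(2)[OF r] coord_def)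
  qed
  ultimately show False by blast
qed

text \<open>
  Since $z_{\alpha_0} = 1$, the equations $g_j = \theta_{\alpha_0}z_j - \theta_j$ are, up to sign, the
  minors that involve column $\alpha_0$. The other minors are combinations of these:
  $\theta_iz_j - \theta_jz_i = z_ig_j - z_jg_i$.
\<close>

lemma T_phi_ideal_eq: "T_phi_ideal d e \<alpha> = genideal A (set (graph_equations d e \<alpha>))"
proof -
  define I where "I = genideal A (two_minors d (phi_matrix d e \<alpha>) :: (nat \<times> nat, 'k) mpoly set)"
  define J where "J = genideal A (set (graph_equations d e \<alpha>) :: (nat \<times> nat, 'k) mpoly set)"
  have minors: "two_minors d (phi_matrix d e \<alpha>)
      = {th i * z_coord \<alpha> j - th j * z_coord \<alpha> i | i j. i < j \<and> j \<le> d}"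
    by (simp add: two_minors_def phi_matrix_def)
  have minors_A: "two_minors d (phi_matrix d e \<alpha> :: _ \<Rightarrow> _ \<Rightarrow> (nat \<times> nat, 'k) mpoly) \<subseteq> carrier A"
    unfolding minors by (auto intro!: A_diff A_carrier(6) theta_in_A z_in_A)
  have graph_A: "set (graph_equations d e \<alpha>) \<subseteq> carrier A"
    unfolding set_graph_equations by (auto intro!: graph_equation_in_A)
  have I: "ideal I A" and J: "ideal J A"
    unfolding I_def J_def by (intro genideal_ideal minors_A graph_A)+
  have z\<alpha>: "z_coord \<alpha> (\<alpha> 0) = (1 :: (nat \<times> nat, 'k) mpoly)"
    by (simp add: coord_def)
  have gJ: "g j \<in> J" if "j \<le> d" for j
  proof (cases "j = \<alpha> 0")
    case True
    thus ?thesis using A_ideal(1)[OF J] by (simp add: graph_equation_def z\<alpha>)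
  next
    case False
    thus ?thesis using genideal_self[OF graph_A] that
      by (auto simp: J_def set_graph_equations)
  qed
  have "th i * z_coord \<alpha> j - th j * z_coord \<alpha> i \<in> J" if ij: "i \<le> d" "j \<le> d" for i j
  proof -
    have "z_coord \<alpha> i * g j - z_coord \<alpha> j * g i \<in> J"
      by (intro A_ideal[OF J] gJ z_in_A ij)
    thus ?thesis by (simp add: graph_equation_def algebra_simps)
  qed
  hence "two_minors d (phi_matrix d e \<alpha>) \<subseteq> J"
    unfolding minors by auto
  hence "I \<subseteq> J"
    unfolding I_def by (rule genideal_minimal[OF J])
  moreover have "g j \<in> I" if j: "j \<le> d" "j \<noteq> \<alpha> 0" for j
  proof -
    have *: "th i * z_coord \<alpha> j - th j * z_coord \<alpha> i \<in> I" if "i < j" "j \<le> d" for i j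
      using genideal_self[OF minors_A] that by (auto simp: I_def minors)
    show ?thesis
    proof (cases "\<alpha> 0 < j")
      case True
      from *[OF this j(1)] show ?thesis by (simp add: graph_equation_def z\<alpha>)
    next
      case False
      with j have "j < \<alpha> 0" by simp
      from A_ideal(5)[OF I *[OF this alpha_le(1)]] show ?thesis
        by (simp add: graph_equation_def z\<alpha>)
    qed
  qed
  hence "J \<subseteq> I"
    unfolding J_def by (intro genideal_minimal[OF I]) (auto simp: set_graph_equations)
  ultimately show ?thesis
    by (simp add: T_phi_ideal_def I_def J_def A_def)
qed

text \<open>
  Solving the equations $g_j$ with $j \in D$ for $z_j = \theta_j/\theta_{\alpha_0}$ defines a homomorphism
  $\psi$ to a field of fractions. Up to powers of $\theta_{\alpha_0}$ its kernel is the ideal of these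
  equations, so after inverting $\theta_{\alpha_0}$ that ideal is prime; and it contains none of the
  remaining $g_j$, because their $z_j$ is still free.
\<close>

lemma eliminate_z:
  fixes D :: "nat set"
  assumes D: "D \<subseteq> {j. j \<le> d \<and> j \<noteq> \<alpha> 0}" and nz: "th (\<alpha> 0) \<noteq> 0"
  obtains \<psi> :: "(nat \<times> nat, 'k) mpoly \<Rightarrow> (nat \<times> nat, 'k) mpoly fract"
  where "unital_ring_hom \<psi>"
    and "\<And>x. x \<in> carrier A \<Longrightarrow> \<psi> x = 0 \<longleftrightarrow> (\<exists>n. th (\<alpha> 0) ^ n * x \<in> genideal A (g ` D))"
    and "\<And>j. j \<le> d \<Longrightarrow> j \<noteq> \<alpha> 0 \<Longrightarrow> j \<notin> D \<Longrightarrow> \<psi> (g j) \<noteq> 0"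
proof -
  let ?t = "th (\<alpha> 0)"
  define h where "h = (\<lambda>c. to_fract (Const c :: (nat \<times> nat, 'k) mpoly))"
  define \<sigma> where "\<sigma> = (\<lambda>(r, j). if r = 0 \<and> j \<in> D then to_fract (th j) / to_fract ?t
      else to_fract (Var (r, j)))"
  define \<psi> where "\<psi> = mpoly_eval h \<sigma>"
  define J where "J = genideal A (g ` D)"
  interpret h: unital_ring_hom h
    unfolding h_def by (rule unital_ring_hom_comp[OF Const_hom to_fract_hom])
  interpret \<psi>: unital_ring_hom \<psi>
    unfolding \<psi>_def by (rule h.mpoly_eval_hom)
  interpret to_fract: unital_ring_hom to_fract by (rule to_fract_hom)
  have \<psi>_Var: "\<psi> (Var v) = \<sigma> v" and \<psi>_Const: "\<psi> (Const c) = h c" for v c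
    by (simp_all add: \<psi>_def h.mpoly_eval_Var h.mpoly_eval_Const)
  have \<psi>_th: "\<psi> (th j) = to_fract (th j)" if "j \<le> d" for j
    by (rule hom_theta_cong[OF \<psi>.unital_ring_hom_axioms to_fract_hom e that])
       (simp add: coord_def \<psi>.hom_one \<psi>_Var \<sigma>_def)
  have \<psi>_z: "\<psi> (z_coord \<alpha> j) = \<sigma> (0, j)" if "j \<noteq> \<alpha> 0" for j
    using that by (simp add: coord_def \<psi>_Var)
  have gD: "g ` D \<subseteq> carrier A"
    using D by (auto intro!: graph_equation_in_A)
  have J: "ideal J A" unfolding J_def by (rule genideal_ideal[OF gD])
  have t: "?t \<in> carrier A" by (rule theta_in_A[OF alpha_le(1)])
  have \<psi>_t: "\<psi> (?t ^ n) = to_fract (?t ^ n)" "to_fract (?t ^ n) \<noteq> 0" for n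
    using nz by (simp_all add: \<psi>.hom_power \<psi>_th alpha_le to_fract.hom_power)

  have J_kernel: "\<psi> x = 0" if "x \<in> J" for x
  proof -
    have "\<psi> (g j) = 0" if j: "j \<in> D" for j
    proof -
      have "j \<le> d" "j \<noteq> \<alpha> 0" using D j by auto
      thus ?thesis using nz j
        by (simp add: graph_equation_def \<psi>.hom_diff \<psi>.hom_mult \<psi>_th \<psi>_z alpha_le \<sigma>_def)
    qed
    hence "g ` D \<subseteq> {p \<in> carrier A. \<psi> p = 0}" using gD by auto
    with that show ?thesis
      using genideal_minimal[OF kernel_is_ideal[OF \<psi>.unital_ring_hom_axioms,
          where X = "chart_vars d e \<alpha>", folded A_eq]]
      unfolding J_def by blast
  qed

  \<comment> \<open>A power of $\theta_{\alpha_0}$ clears the denominators: modulo the ideal, it turns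
    $x$ into a polynomial $y$ that $\psi$ maps to its canonical image. If $\psi(x) = 0$,
    this forces $y = 0$.\<close>
  have clear: "x \<in> carrier A \<and> (\<exists>n y. y \<in> carrier A \<and> ?t ^ n * x - y \<in> J
      \<and> \<psi> (?t ^ n * x) = to_fract y)" if "x \<in> carrier A" for x
    using that unfolding A_eq
  proof (induction x rule: mpoly_ring_induct)
    case (Const c)
    show ?case unfolding A_eq[symmetric]
      using A_ideal(1)[OF J] A_carrier(3)
      by (auto intro!: exI[of _ 0] exI[of _ "Const c"] simp: \<psi>_Const h_def)
  next
    case (Var v)
    obtain r j where v: "v = (r, j)" by (cases v)
    show ?case
    proof (cases "r = 0 \<and> j \<in> D")
      case True
      hence j: "j \<le> d" "j \<noteq> \<alpha> 0" "j \<in> D" using D by auto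
      have z: "z_coord \<alpha> j = (Var v :: (nat \<times> nat, 'k) mpoly)"
        using True j by (simp add: coord_def v)
      have "g j \<in> J" using genideal_self[OF gD] j unfolding J_def by blast
      hence "?t ^ 1 * Var v - th j \<in> J" by (simp add: graph_equation_def z)
      moreover have "\<psi> (?t ^ 1 * Var v) = to_fract (th j)"
        using True nz by (simp add: \<psi>.hom_mult \<psi>_th alpha_le \<psi>_Var v \<sigma>_def)
      ultimately show ?thesis unfolding A_eq[symmetric]
        using theta_in_A[OF j(1)] A_carrier(4)[OF Var] by blast
    next
      case False
      hence "\<psi> (?t ^ 0 * Var v) = to_fract (Var v)"
        by (auto simp: \<psi>_Var v \<sigma>_def)
      moreover have "?t ^ 0 * Var v - Var v \<in> J" using A_ideal(1)[OF J] by simp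
      ultimately show ?thesis unfolding A_eq[symmetric]
        using A_carrier(4)[OF Var] by blast
    qed
  next
    case (add p q)
    from add obtain m y n z where *: "p \<in> carrier A" "q \<in> carrier A" "y \<in> carrier A" "z \<in> carrier A"
      "?t ^ m * p - y \<in> J" "?t ^ n * q - z \<in> J"
      "\<psi> (?t ^ m * p) = to_fract y" "\<psi> (?t ^ n * q) = to_fract z"
      unfolding A_eq[symmetric] by blast
    have "?t ^ (m + n) * (p + q) - (?t ^ n * y + ?t ^ m * z)
        = ?t ^ n * (?t ^ m * p - y) + ?t ^ m * (?t ^ n * q - z)"
      by (simp add: power_add algebra_simps)
    also have "\<dots> \<in> J" by (intro A_ideal[OF J] A_power t *)
    finally have "?t ^ (m + n) * (p + q) - (?t ^ n * y + ?t ^ m * z) \<in> J" .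
    moreover have "\<psi> (?t ^ (m + n) * (p + q)) = to_fract (?t ^ n * y + ?t ^ m * z)"
    proof -
      have "?t ^ (m + n) * (p + q) = ?t ^ n * (?t ^ m * p) + ?t ^ m * (?t ^ n * q)"
        by (simp add: power_add algebra_simps)
      thus ?thesis
        by (simp only: \<psi>.hom_add \<psi>.hom_mult[of "?t ^ n" "?t ^ m * p"]
            \<psi>.hom_mult[of "?t ^ m" "?t ^ n * q"] *(7,8) \<psi>_t to_fract_add to_fract_mult)
    qed
    moreover have "?t ^ n * y + ?t ^ m * z \<in> carrier A"
      by (intro A_carrier(5,6) A_power t *)
    ultimately show ?case unfolding A_eq[symmetric]
      using A_carrier(5)[OF *(1,2)] by blast
  next
    case (mult p q)
    from mult obtain m y n z where *: "p \<in> carrier A" "q \<in> carrier A" "y \<in> carrier A" "z \<in> carrier A"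
      "?t ^ m * p - y \<in> J" "?t ^ n * q - z \<in> J"
      "\<psi> (?t ^ m * p) = to_fract y" "\<psi> (?t ^ n * q) = to_fract z"
      unfolding A_eq[symmetric] by blast
    have "?t ^ (m + n) * (p * q) - y * z
        = (?t ^ m * p) * (?t ^ n * q - z) + z * (?t ^ m * p - y)"
      by (simp add: power_add algebra_simps)
    also have "\<dots> \<in> J" by (intro A_ideal[OF J] A_carrier(6) A_power t *)
    finally have "?t ^ (m + n) * (p * q) - y * z \<in> J" .
    moreover have "\<psi> (?t ^ (m + n) * (p * q)) = to_fract (y * z)"
    proof -
      have "?t ^ (m + n) * (p * q) = (?t ^ m * p) * (?t ^ n * q)"
        by (simp add: power_add mult_ac)
      thus ?thesis
        by (simp only: \<psi>.hom_mult[of "?t ^ m * p" "?t ^ n * q"] *(7,8) to_fract_mult)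
    qed
    ultimately show ?case unfolding A_eq[symmetric]
      using A_carrier(6)[OF *(1,2)] A_carrier(6)[OF *(3,4)] by blast
  qed

  have kernel: "\<psi> x = 0 \<longleftrightarrow> (\<exists>n. ?t ^ n * x \<in> J)" if x: "x \<in> carrier A" for x
  proof
    assume "\<psi> x = 0"
    with clear[OF x] obtain n y where "?t ^ n * x - y \<in> J" "to_fract y = 0"
      by (auto simp: \<psi>.hom_mult)
    thus "\<exists>n. ?t ^ n * x \<in> J" by (auto intro!: exI[of _ n])
  next
    assume "\<exists>n. ?t ^ n * x \<in> J"
    then obtain n where "?t ^ n * x \<in> J" ..
    from J_kernel[OF this] show "\<psi> x = 0"
      using \<psi>_t(2)[of n] by (simp only: \<psi>.hom_mult \<psi>_t(1) mult_eq_0_iff) simp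
  qed

  have new: "\<psi> (g j) \<noteq> 0" if j: "j \<le> d" "j \<noteq> \<alpha> 0" "j \<notin> D" for j
  proof
    interpret Const: unital_ring_hom Const by (rule Const_hom)
    assume "\<psi> (g j) = 0"
    hence "to_fract (?t * Var (0, j)) = to_fract (th j)"
      using j by (simp add: graph_equation_def \<psi>.hom_diff \<psi>.hom_mult \<psi>_th \<psi>_z alpha_le \<sigma>_def)
    hence eq: "?t * Var (0, j) = th j" by (simp only: to_fract_eq_iff)
    \<comment> \<open>The $\theta_i$ do not involve $z_j$, so $z_j$ may be specialized to any $c$.\<close>
    have spec: "?t * c = th j" for c
    proof -
      define \<eta> where "\<eta> = mpoly_eval Const (\<lambda>v. if v = (0, j) then c else Var v)"
      interpret \<eta>: unital_ring_hom \<eta> unfolding \<eta>_def by (rule Const.mpoly_eval_hom)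
      have \<eta>: "\<eta> (th i) = th i" if "i \<le> d" for i
        by (rule hom_theta_cong[OF \<eta>.unital_ring_hom_axioms id_hom e that])
           (auto simp: coord_def \<eta>.hom_one, simp add: \<eta>_def Const.mpoly_eval_Var)
      have "\<eta> (Var (0, j)) = c" by (simp add: \<eta>_def Const.mpoly_eval_Var)
      with arg_cong[OF eq, of \<eta>] show ?thesis
        by (simp add: \<eta>.hom_mult \<eta> alpha_le j)
    qed
    from spec[of 0] spec[of 1] nz show False by simp
  qed
  show ?thesis
    by (rule that[OF \<psi>.unital_ring_hom_axioms kernel[unfolded J_def] new])
qed

text \<open>
  Let $s g_j x$ be in the ideal $J$ of the preceding equations, with $s \notin P$. The homomorphism
  $\psi$ that belongs to these equations kills $s g_j x$, but neither $g_j$ nor $s$: if it killed $s$,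
  then $\theta_{\alpha_0}^n s \in J \subseteq P$ for some $n$, while neither factor is in $P$.
  Hence it kills $x$, which means that $\theta_{\alpha_0}^n x \in J$ for some $n$.
\<close>

lemma regular_sequence_graph_germs:
  assumes P: "primeideal P A" and gP: "set (graph_equations d e \<alpha>) \<subseteq> P"
  shows "regular_sequence (local_ring_at A P) (map (germ A P) (graph_equations d e \<alpha>))"
proof (rule regular_sequence_germs[OF P gP])
  interpret P: primeideal P A by fact
  let ?js = "filter (\<lambda>j. j \<noteq> \<alpha> 0) [0..<Suc d]" and ?fs = "graph_equations d e \<alpha>"
  let ?t = "th (\<alpha> 0)"
  have js: "set ?js = {j. j \<le> d \<and> j \<noteq> \<alpha> 0}" by (auto simp del: upt_Suc)
  have t: "?t \<notin> P"
    by (rule theta_not_in_prime[OF P]) (use gP in \<open>auto simp: set_graph_equations\<close>)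
  have tA: "?t \<in> carrier A" by (rule theta_in_A[OF alpha_le(1)])
  have nz: "?t \<noteq> 0" using t A_ideal(1)[OF P.ideal_axioms] by auto
  have tn: "?t ^ n \<in> carrier A - P" for n
  proof (induction n)
    case 0
    show ?case using P.I_notcarr P.one_imp_carrier A_carrier(2) by (auto simp: A_eq)
  next
    case (Suc n)
    thus ?case using P.I_prime[OF tA, of "?t ^ n"] t A_carrier(6)[OF tA] by (auto simp: A_eq)
  qed
  fix i x s
  assume i: "i < length ?fs" and x: "x \<in> carrier A" and s: "s \<in> carrier A - P"
    and *: "s \<otimes>\<^bsub>A\<^esub> (?fs ! i \<otimes>\<^bsub>A\<^esub> x) \<in> genideal A (set (take i ?fs))"
  define D where "D = set (take i ?js)"
  have i': "i < length ?js" using i by (simp only: graph_equations_eq length_map)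
  have D: "D \<subseteq> {j. j \<le> d \<and> j \<noteq> \<alpha> 0}"
    unfolding D_def js[symmetric] by (rule set_take_subset)
  have gD: "set (take i ?fs) = g ` D"
    by (simp only: graph_equations_eq take_map set_map D_def)
  have fi: "?fs ! i = g (?js ! i)" by (simp only: graph_equations_eq nth_map[OF i'])
  have "?js ! i \<in> set ?js" by (rule nth_mem[OF i'])
  hence j: "?js ! i \<le> d" "?js ! i \<noteq> \<alpha> 0" unfolding js by auto
  have "distinct ?js" by simp
  hence "distinct (take (Suc i) ?js)" by (rule distinct_take)
  hence jD: "?js ! i \<notin> D"
    unfolding D_def take_Suc_conv_app_nth[OF i'] by simp
  obtain \<psi> :: "(nat \<times> nat, 'k) mpoly \<Rightarrow> (nat \<times> nat, 'k) mpoly fract" where \<psi>: "unital_ring_hom \<psi>"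
    and ker: "\<And>x. x \<in> carrier A \<Longrightarrow> \<psi> x = 0 \<longleftrightarrow> (\<exists>n. ?t ^ n * x \<in> genideal A (g ` D))"
    and new: "\<And>j. j \<le> d \<Longrightarrow> j \<noteq> \<alpha> 0 \<Longrightarrow> j \<notin> D \<Longrightarrow> \<psi> (g j) \<noteq> 0"
    using eliminate_z[OF D nz] by blast
  interpret \<psi>: unital_ring_hom \<psi> by fact
  have JP: "genideal A (g ` D) \<subseteq> P"
    using gP set_take_subset[of i ?fs] unfolding gD[symmetric]
    by (intro genideal_minimal[OF P.ideal_axioms]) auto
  have "\<psi> s \<noteq> 0"
  proof
    assume "\<psi> s = 0"
    then obtain n where "?t ^ n * s \<in> P" using ker s JP by blast
    thus False using P.I_prime[of "?t ^ n" s] tn[of n] s by (auto simp: A_eq)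
  qed
  moreover have "\<psi> (s * (g (?js ! i) * x)) = 0"
  proof -
    have "s * (g (?js ! i) * x) \<in> genideal A (g ` D)"
      using * unfolding gD fi by (simp add: A_eq)
    thus ?thesis using s x graph_equation_in_A[OF j(1)]
      by (subst ker) (auto intro!: A_carrier(6) exI[of _ 0])
  qed
  ultimately have "\<psi> x = 0"
    using new[OF j jD] by (simp add: \<psi>.hom_mult)
  then obtain n where "?t ^ n * x \<in> genideal A (g ` D)" using ker[OF x] by blast
  thus "\<exists>u\<in>carrier A - P. u \<otimes>\<^bsub>A\<^esub> x \<in> genideal A (set (take i ?fs))"
    using tn[of n] unfolding gD by (auto simp: A_eq)
qed

end

text \<open>
  The equations have a common zero over the base field: take for every form a multiple of $(x+y)^{e_r}$.
  In characteristic $0$ its coefficients do not vanish, so it can be normalized at $\alpha_r$; the product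
  is a multiple of $(x+y)^d$, whose coefficient at $\alpha_0$ does not vanish either, and normalizing it
  there gives the $z_j$.
\<close>

lemma graph_equations_proper:
  fixes d :: nat and e \<alpha> :: "nat \<Rightarrow> nat" and A :: "(nat \<times> nat, 'k::field_char_0) mpoly ring"
  assumes e: "(\<Sum>r=1..d. r * e r) = d" and \<alpha>: "\<alpha> \<in> Lam d e"
  defines "A \<equiv> chart_ring d e \<alpha>"
  shows "genideal A (set (graph_equations d e \<alpha>)) \<noteq> carrier A"
proof
  interpret cring A
    unfolding A_def chart_ring_def by (rule cring_mpoly_ring)
  note alpha_le = alpha_le[OF e \<alpha>]
  define c where "c = (\<lambda>r. of_nat (e r choose \<alpha> r) :: 'k)"
  have c: "c r \<noteq> 0" if "r \<in> {1..d}" for r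
    using alpha_le(2)[OF that] by (simp add: c_def)
  have d: "(of_nat (d choose \<alpha> 0) :: 'k) \<noteq> 0"
    using alpha_le(1) by simp
  define \<sigma> where "\<sigma> = (\<lambda>(r, t). if r = 0 then of_nat (d choose t) / of_nat (d choose \<alpha> 0)
      else of_nat (e r choose t) / c r :: 'k)"
  define \<psi> where "\<psi> = mpoly_eval (\<lambda>x. x) \<sigma>"
  interpret I: unital_ring_hom "\<lambda>x::'k. x" by (rule id_hom)
  interpret \<psi>: unital_ring_hom \<psi> unfolding \<psi>_def by (rule I.mpoly_eval_hom)
  define C where "C = (\<Prod>r=1..d. (1 / c r) ^ r)"
  have C: "C \<noteq> 0" using c by (auto simp: C_def)
  have binomial: "(\<Sum>t=0..n. Polynomial.monom (of_nat (n choose t)) t) = [:1, 1 :: 'k:] ^ n" for n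
  proof -
    have "[:1, 1 :: 'k:] = Polynomial.monom 1 1 + 1"
      by (simp add: monom_altdef one_pCons)
    thus ?thesis
      by (simp add: binomial_ring monom_power of_nat_poly mult_monom atMost_atLeast0 smult_monom)
  qed
  have coord: "\<psi> (coord \<alpha> (r, t)) = 1 / c r * of_nat (e r choose t)" if "r \<in> {1..d}" for r t
    using c[OF that] that
    by (auto simp: coord_def \<psi>.hom_one c_def, simp add: \<psi>_def I.mpoly_eval_Var \<sigma>_def c_def)
  have "(\<Sum>t=0..e r. Polynomial.monom (\<psi> (coord \<alpha> (r, t))) t) ^ r
      = Polynomial.smult ((1 / c r) ^ r) ([:1, 1:] ^ (r * e r))" if r: "r \<in> {1..d}" for r
  proof -
    have "(\<Sum>t=0..e r. Polynomial.monom (\<psi> (coord \<alpha> (r, t))) t)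
        = Polynomial.smult (1 / c r) (\<Sum>t=0..e r. Polynomial.monom (of_nat (e r choose t)) t)"
      by (rule poly_eqI) (simp add: coord[OF r] Polynomial.coeff_sum when_def)
    thus ?thesis
      by (simp only: binomial smult_power power_mult[symmetric] mult.commute[of "e r" r])
  qed
  hence "(\<Prod>r=1..d. (\<Sum>t=0..e r. Polynomial.monom (\<psi> (coord \<alpha> (r, t))) t) ^ r)
      = (\<Prod>r=1..d. Polynomial.smult ((1 / c r) ^ r) ([:1, 1:] ^ (r * e r)))"
    by (intro prod.cong) auto
  also have "\<dots> = Polynomial.smult C ([:1, 1:] ^ d)"
    by (simp only: prod_smult C_def power_sum[symmetric] e)
  finally have th: "\<psi> (theta d e \<alpha> j) = C * of_nat (d choose j)" if "j \<le> d" for j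
    using that unfolding coeff_hom_theta[OF \<psi>.unital_ring_hom_axioms e that]
    by (simp add: binomial[symmetric] Polynomial.coeff_sum when_def)
  have "\<psi> (graph_equation d e \<alpha> j) = 0" if j: "j \<le> d" "j \<noteq> \<alpha> 0" for j
  proof -
    have "\<psi> (z_coord \<alpha> j) = of_nat (d choose j) / of_nat (d choose \<alpha> 0)"
      using j by (simp add: coord_def \<psi>_def I.mpoly_eval_Var \<sigma>_def)
    thus ?thesis using d
      by (simp add: graph_equation_def \<psi>.hom_diff \<psi>.hom_mult th alpha_le j)
  qed
  hence "set (graph_equations d e \<alpha>) \<subseteq> {p \<in> carrier A. \<psi> p = 0}"
    unfolding set_graph_equations A_def using graph_equation_in_A[OF e \<alpha>] by auto
  hence "genideal A (set (graph_equations d e \<alpha>)) \<subseteq> {p \<in> carrier A. \<psi> p = 0}"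
    using kernel_is_ideal[OF \<psi>.unital_ring_hom_axioms]
    by (intro genideal_minimal) (auto simp: A_def chart_ring_def)
  moreover assume "genideal A (set (graph_equations d e \<alpha>)) = carrier A"
  ultimately have "\<psi> \<one>\<^bsub>A\<^esub> = 0" using one_closed by auto
  thus False by (simp add: A_def chart_ring_def \<psi>.hom_one)
qed

theorem proposition1p3:
  fixes d :: nat and e \<alpha> :: "nat \<Rightarrow> nat"
    and A :: "(nat \<times> nat, 'k::{alg_closed_field, field_char_0}) mpoly ring"
    and I :: "(nat \<times> nat, 'k) mpoly set"
  assumes "d \<ge> 1"
    and "(\<Sum>r=1..d. r * e r) = d"
    and "\<alpha> \<in> Lam d e"
  defines "A \<equiv> chart_ring d e \<alpha>"
    and "I \<equiv> T_phi_ideal d e \<alpha>"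
  shows "(\<forall>P\<in>zero_locus A I. theta d e \<alpha> (\<alpha> 0) \<notin> P) \<and>
         I +>\<^bsub>A\<^esub> theta d e \<alpha> (\<alpha> 0) \<in> Units (A Quot I) \<and>
         I = genideal A (set (graph_equations d e \<alpha>)) \<and>
         regular_along_zero_locus A (graph_equations d e \<alpha>)"
proof -
  note e = assms(2) and \<alpha> = assms(3)
  interpret cring A
    unfolding A_def chart_ring_def by (rule cring_mpoly_ring)
  let ?G = "set (graph_equations d e \<alpha>) :: (nat \<times> nat, 'k) mpoly set"
  have I_eq: "I = genideal A ?G"
    unfolding I_def A_def by (rule T_phi_ideal_eq[OF e \<alpha>])
  have G: "?G \<subseteq> carrier A"
    unfolding set_graph_equations A_def using graph_equation_in_A[OF e \<alpha>] by auto
  have I: "ideal I A" unfolding I_eq by (rule genideal_ideal[OF G])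
  have avoid: "theta d e \<alpha> (\<alpha> 0) \<notin> P" if "primeideal P A" "I \<subseteq> P" for P
    using that genideal_self[OF G] unfolding I_eq A_def
    by (intro theta_not_in_prime[OF e \<alpha>]) (auto simp: set_graph_equations)
  have "theta d e \<alpha> (\<alpha> 0) \<in> carrier A"
    unfolding A_def by (rule theta_in_A[OF e \<alpha> alpha_le(1)[OF e \<alpha>]])
  hence "I +>\<^bsub>A\<^esub> theta d e \<alpha> (\<alpha> 0) \<in> Units (A Quot I)"
    by (rule coset_Units_if_avoids_primes[OF I _ avoid])
  moreover have "regular_along_zero_locus A (graph_equations d e \<alpha>)"
    unfolding regular_along_zero_locus_def zero_locus_def Spec_def
    using G graph_equations_proper[OF e \<alpha>, where 'k = 'k]
      regular_sequence_graph_germs[OF e \<alpha>, where 'k = 'k]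
    by (auto simp: A_def)
  ultimately show ?thesis
    using avoid I_eq by (auto simp: zero_locus_def Spec_def)
qed

end
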